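(* Let $(\Omega,\mathcal{A},T,\mu,\mathcal{F},\|\cdot\|,\chi)$ fulfill Property $\mathfrak{D}$, and assume that $\mu(\chi>x)=L(x)/x^{\alpha}$ (for $x>0$), where $L$ is a slowly varying function and $0<\alpha<1$. Let $(b_n)_{n\in\mathbb{N}}$ be a sequence of natural numbers tending to infinity such that $b_n=o(n)$. Assume that at least one $\psi$-mixing coefficient of the sequence of random variables $(\chi\circ T^{n-1})_{n\in\mathbb{N}}$ is strictly less than one, i.e. $\psi(r)<1$ for some $r\in\mathbb{N}$. Define $$d_n:=\frac{\alpha}{1-\alpha}\cdot n^{1/\alpha}\cdot b_n^{1-1/\alpha}\cdot\left(L^{-1/\alpha}\right)^{\#}\left(\left(\frac{n}{b_n}\right)^{1/\alpha}\right).$$ Then $\int\mathsf{S}_n^{b_n}\chi\,\mathrm{d}\mu\sim d_n$, that is, $$\lim_{n\to\infty}\frac{\int\mathsf{S}_n^{b_n}\chi\,\mathrm{d}\mu}{d_n}=1 .$$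
   Context: Here $\mathbb{N}=\{1,2,\dots\}$. **Spectral gap.** A bounded linear operator $U:\mathcal{F}\to\mathcal{F}$ on a Banach space has a spectral gap if $U=\lambda P+N$ with $\lambda\in\mathbb{C}$ and $P,N$ bounded linear operators such that $P^2=P$ has one-dimensional image, the spectral radius of $N$ satisfies $\rho(N)<|\lambda|$, and $PN=NP=0$. **Property $\mathfrak{C}$.** Let $(\Omega,\mathcal{A},T,\mu)$ be a dynamical system with $T$ a non-singular transformation, and let $\widehat{T}:\mathcal{L}^1\to\mathcal{L}^1$ be its transfer operator, i.e. the unique operator with $\int\widehat{T}f\cdot g\,\mathrm{d}\mu=\int f\cdot g\circ T\,\mathrm{d}\mu$ for all $f\in\mathcal{L}^1$, $g\in\mathcal{L}^\infty$. Let $\mathcal{F}$ be a subset of the measurable functions forming a Banach algebra with respect to the norm $\|\cdot\|$. Then $(\Omega,\mathcal{A},T,\mu,\mathcal{F},\|\cdot\|)$ has Property $\mathfrak{C}$ if: (1) $\mu$ is a $T$-invariant, mixing probability measure; (2) $\mathcal{F}$ contains the constant functions and $\|f\|\ge|f|_\infty$ for all $f\in\mathcal{F}$; (3) there is a constant $K_0>0$ with $\|\widehat{T}f\|\le K_0\|f\|$ for all $f\in\mathcal{F}$; (4) $\widehat{T}$ acting on $(\mathcal{F},\|\cdot\|)$ has a spectral gap. **Property $\mathfrak{D}$.** $(\Omega,\mathcal{A},T,\mu,\mathcal{F},\|\cdot\|,\chi)$ has Property $\mathfrak{D}$ if $(\Omega,\mathcal{A},T,\mu,\mathcal{F},\|\cdot\|)$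 has Property $\mathfrak{C}$, $\chi:\Omega\to\mathbb{R}_{\ge0}$ is $\mathcal{A}$-measurable, and there is $K_1>0$ such that for all $\ell\in\mathbb{R}_{\ge0}$: $\|\chi\cdot\mathbf{1}_{\{\chi\le\ell\}}\|\le K_1\ell$ and $\|\mathbf{1}_{\{\chi>\ell\}}\|\le K_1$ (in particular, these functions belong to $\mathcal{F}$). **Trimmed sums.** For $n\in\mathbb{N}$ and $b\in\mathbb{N}_0$, $\mathsf{S}_n^{b}\chi$ is the sum of the $n$ values $\chi,\chi\circ T,\dots,\chi\circ T^{n-1}$ with the $b$ largest of them removed: pointwise, if $\chi\circ T^{\sigma(1)}\ge\dots\ge\chi\circ T^{\sigma(n)}$ is a decreasing ordering, where $\sigma:\{1,\dots,n\}\to\{0,\dots,n-1\}$ is a (point-dependent) bijection, then $\mathsf{S}_n^b\chi=\sum_{k=b+1}^{n}\chi\circ T^{\sigma(k)}$ (an empty sum is $0$). **Slow variation and de Bruijn conjugate.** $L$ is slowly varying if $\lim_{x\to\infty}L(cx)/L(x)=1$ for every $c>0$. For a slowly varying function $\ell$, $\ell^{\#}$ denotes a de Bruijn conjugate of $\ell$, i.e. a slowly varying function with $\lim_{x\to\infty}\ell(x)\,\ell^{\#}(x\ell(x))=1=\lim_{x\to\infty}\ell^{\#}(x)\,\ell(x\ell^{\#}(x))$ (it is unique up to asymptotic equivalence); $L^{-1/\alpha}$ denotes the function $x\mapsto L(x)^{-1/\alpha}$. **$\psi$-mixing coefficients.** For sub-$\sigma$-fields $\mathcal{B},\mathcal{C}$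 of a probability space with measure $\mathbb{P}$, $\psi(\mathcal{B},\mathcal{C}):=\sup\left\{\left|\frac{\mathbb{P}(B\cap C)}{\mathbb{P}(B)\mathbb{P}(C)}-1\right|: B\in\mathcal{B},\,C\in\mathcal{C},\,\mathbb{P}(B),\mathbb{P}(C)>0\right\}$. For a sequence $(X_n)_{n\in\mathbb{N}}$ of random variables, $\psi(n):=\sup_{k\in\mathbb{N}}\psi\big(\sigma(X_j:1\le j\le k),\,\sigma(X_j:j\ge k+n)\big)$. Here $\mathbb{P}=\mu$ and $X_n=\chi\circ T^{n-1}$. *)

theory Defs
  imports "HOL-Probability.Probability"
begin

section \<open>Non-singular systems and their transfer operators\<close>

text \<open>A measure space \<open>(\<Omega>, \<A>, \<mu>)\<close> is a value \<open>M\<close> of type \<open>'a measure\<close>.\<close>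

definition nonsingular_map :: "'a measure \<Rightarrow> ('a \<Rightarrow> 'a) \<Rightarrow> bool" where
  "nonsingular_map M T \<longleftrightarrow> T \<in> measurable M M \<and>
     (\<forall>A\<in>sets M. emeasure M (T -` A \<inter> space M) = 0 \<longleftrightarrow> emeasure M A = 0)"

definition invariant_measure :: "'a measure \<Rightarrow> ('a \<Rightarrow> 'a) \<Rightarrow> bool" where
  "invariant_measure M T \<longleftrightarrow> T \<in> measurable M M \<and>
     (\<forall>A\<in>sets M. emeasure M (T -` A \<inter> space M) = emeasure M A)"

definition mixing_measure :: "'a measure \<Rightarrow> ('a \<Rightarrow> 'a) \<Rightarrow> bool" where
  "mixing_measure M T \<longleftrightarrow>
     (\<forall>A\<in>sets M. \<forall>B\<in>sets M.
        (\<lambda>n. measure M (A \<inter> ((T ^^ n) -` B \<inter> space M))) \<longlonglongrightarrow> measure M A * measure M B)"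

definition L_infinity :: "'a measure \<Rightarrow> ('a \<Rightarrow> complex) set" where
  "L_infinity M = {g \<in> borel_measurable M. \<exists>C. AE x in M. cmod (g x) \<le> C}"

text \<open>The defining relation determines the image of \<open>f\<close> only up to a null set; the choice operator
  picks a representative. All notions below are insensitive to that choice.\<close>

definition transfer_operator ::
    "'a measure \<Rightarrow> ('a \<Rightarrow> 'a) \<Rightarrow> ('a \<Rightarrow> complex) \<Rightarrow> ('a \<Rightarrow> complex)" where
  "transfer_operator M T f = (SOME h. integrable M h \<and>
     (\<forall>g\<in>L_infinity M. (\<integral>x. h x * g x \<partial>M) = (\<integral>x. f x * g (T x) \<partial>M)))"

section \<open>Banach algebras of functions and spectral gap\<close>

text \<open>Functions that agree almost everywhere are identified. Such a space of classes is
  represented by the set \<open>F\<close> of all representatives, so \<open>F\<close> is closed under changes on null sets,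
  the norm is constant on classes, and equations between elements hold almost everywhere.\<close>

definition banach_fun_algebra ::
    "'a measure \<Rightarrow> ('a \<Rightarrow> complex) set \<Rightarrow> (('a \<Rightarrow> complex) \<Rightarrow> real) \<Rightarrow> bool" where
  "banach_fun_algebra M F nrm \<longleftrightarrow>
     F \<subseteq> borel_measurable M \<and>
     (\<forall>f\<in>F. \<forall>g\<in>borel_measurable M. (AE x in M. f x = g x) \<longrightarrow> g \<in> F \<and> nrm g = nrm f) \<and>
     (\<lambda>x. 0) \<in> F \<and>
     (\<forall>f\<in>F. \<forall>g\<in>F. (\<lambda>x. f x + g x) \<in> F) \<and>
     (\<forall>c. \<forall>f\<in>F. (\<lambda>x. c * f x) \<in> F) \<and>
     (\<forall>f\<in>F. \<forall>g\<in>F. (\<lambda>x. f x * g x) \<in> F) \<and>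
     (\<forall>f\<in>F. nrm f \<ge> 0 \<and> (nrm f = 0 \<longleftrightarrow> (AE x in M. f x = 0))) \<and>
     (\<forall>f\<in>F. \<forall>g\<in>F. nrm (\<lambda>x. f x + g x) \<le> nrm f + nrm g) \<and>
     (\<forall>c. \<forall>f\<in>F. nrm (\<lambda>x. c * f x) = cmod c * nrm f) \<and>
     (\<forall>f\<in>F. \<forall>g\<in>F. nrm (\<lambda>x. f x * g x) \<le> nrm f * nrm g) \<and>
     (\<forall>u :: nat \<Rightarrow> 'a \<Rightarrow> complex.
        (\<forall>n. u n \<in> F) \<and>
        (\<forall>e>0. \<exists>N. \<forall>m\<ge>N. \<forall>n\<ge>N. nrm (\<lambda>x. u m x - u n x) < e) \<longrightarrow>
        (\<exists>f\<in>F. (\<lambda>n. nrm (\<lambda>x. u n x - f x)) \<longlonglongrightarrow> 0))"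

definition bounded_operator ::
    "'a measure \<Rightarrow> ('a \<Rightarrow> complex) set \<Rightarrow> (('a \<Rightarrow> complex) \<Rightarrow> real) \<Rightarrow>
     (('a \<Rightarrow> complex) \<Rightarrow> ('a \<Rightarrow> complex)) \<Rightarrow> bool" where
  "bounded_operator M F nrm U \<longleftrightarrow>
     (\<forall>f\<in>F. U f \<in> F) \<and>
     (\<forall>f\<in>F. \<forall>g\<in>F. AE x in M. U (\<lambda>x. f x + g x) x = U f x + U g x) \<and>
     (\<forall>c. \<forall>f\<in>F. AE x in M. U (\<lambda>x. c * f x) x = c * U f x) \<and>
     (\<exists>K. \<forall>f\<in>F. nrm (U f) \<le> K * nrm f)"

definition operator_spectrum ::
    "'a measure \<Rightarrow> ('a \<Rightarrow> complex) set \<Rightarrow> (('a \<Rightarrow> complex) \<Rightarrow> real) \<Rightarrow>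
     (('a \<Rightarrow> complex) \<Rightarrow> ('a \<Rightarrow> complex)) \<Rightarrow> complex set" where
  "operator_spectrum M F nrm U =
     {z. \<not> (\<exists>V. bounded_operator M F nrm V \<and>
               (\<forall>f\<in>F. AE x in M. V (\<lambda>y. U f y - z * f y) x = f x) \<and>
               (\<forall>f\<in>F. AE x in M. U (V f) x - z * V f x = f x))}"

text \<open>For a bounded operator on a nonzero complex Banach space the spectrum is nonempty and
  bounded, so this is a supremum in the proper sense.\<close>

definition operator_spectral_radius ::
    "'a measure \<Rightarrow> ('a \<Rightarrow> complex) set \<Rightarrow> (('a \<Rightarrow> complex) \<Rightarrow> real) \<Rightarrow>
     (('a \<Rightarrow> complex) \<Rightarrow> ('a \<Rightarrow> complex)) \<Rightarrow> real" where
  "operator_spectral_radius M F nrm U = Sup (cmod ` operator_spectrum M F nrm U)"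

definition one_dim_image ::
    "'a measure \<Rightarrow> ('a \<Rightarrow> complex) set \<Rightarrow> (('a \<Rightarrow> complex) \<Rightarrow> ('a \<Rightarrow> complex)) \<Rightarrow> bool" where
  "one_dim_image M F P \<longleftrightarrow>
     (\<exists>h\<in>F. \<not> (AE x in M. h x = 0) \<and>
        (\<forall>f\<in>F. \<exists>c. AE x in M. P f x = c * h x) \<and>
        (\<forall>c. \<exists>f\<in>F. AE x in M. P f x = c * h x))"

definition has_spectral_gap ::
    "'a measure \<Rightarrow> ('a \<Rightarrow> complex) set \<Rightarrow> (('a \<Rightarrow> complex) \<Rightarrow> real) \<Rightarrow>
     (('a \<Rightarrow> complex) \<Rightarrow> ('a \<Rightarrow> complex)) \<Rightarrow> bool" where
  "has_spectral_gap M F nrm U \<longleftrightarrow>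
     bounded_operator M F nrm U \<and>
     (\<exists>lam P N.
        bounded_operator M F nrm P \<and> bounded_operator M F nrm N \<and>
        (\<forall>f\<in>F. AE x in M. U f x = lam * P f x + N f x) \<and>
        (\<forall>f\<in>F. AE x in M. P (P f) x = P f x) \<and>
        one_dim_image M F P \<and>
        operator_spectral_radius M F nrm N < cmod lam \<and>
        (\<forall>f\<in>F. AE x in M. P (N f) x = 0) \<and>
        (\<forall>f\<in>F. AE x in M. N (P f) x = 0))"

section \<open>Properties C and D\<close>

definition property_C ::
    "'a measure \<Rightarrow> ('a \<Rightarrow> 'a) \<Rightarrow> ('a \<Rightarrow> complex) set \<Rightarrow> (('a \<Rightarrow> complex) \<Rightarrow> real) \<Rightarrow> bool" where
  "property_C M T F nrm \<longleftrightarrow>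
     nonsingular_map M T \<and>
     banach_fun_algebra M F nrm \<and>
     prob_space M \<and> invariant_measure M T \<and> mixing_measure M T \<and>
     (\<forall>c. (\<lambda>x. c) \<in> F) \<and>
     (\<forall>f\<in>F. esssup M (\<lambda>x. ereal (cmod (f x))) \<le> ereal (nrm f)) \<and>
     (\<exists>K0>0. \<forall>f\<in>F. transfer_operator M T f \<in> F \<and>
        nrm (transfer_operator M T f) \<le> K0 * nrm f) \<and>
     has_spectral_gap M F nrm (transfer_operator M T)"

definition property_D ::
    "'a measure \<Rightarrow> ('a \<Rightarrow> 'a) \<Rightarrow> ('a \<Rightarrow> complex) set \<Rightarrow> (('a \<Rightarrow> complex) \<Rightarrow> real) \<Rightarrow>
     ('a \<Rightarrow> real) \<Rightarrow> bool" where
  "property_D M T F nrm chi \<longleftrightarrow>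
     property_C M T F nrm \<and>
     chi \<in> borel_measurable M \<and> (\<forall>x\<in>space M. chi x \<ge> 0) \<and>
     (\<exists>K1>0. \<forall>l\<ge>0.
        (\<lambda>x. complex_of_real (chi x * indicator {y. chi y \<le> l} x)) \<in> F \<and>
        nrm (\<lambda>x. complex_of_real (chi x * indicator {y. chi y \<le> l} x)) \<le> K1 * l \<and>
        (\<lambda>x. complex_of_real (indicator {y. chi y > l} x)) \<in> F \<and>
        nrm (\<lambda>x. complex_of_real (indicator {y. chi y > l} x)) \<le> K1)"

section \<open>Trimmed sums\<close>

definition trimmed_sum :: "('a \<Rightarrow> 'a) \<Rightarrow> ('a \<Rightarrow> real) \<Rightarrow> nat \<Rightarrow> nat \<Rightarrow> 'a \<Rightarrow> real" where
  "trimmed_sum T chi n b x = sum_list (drop b (rev (sort (map (\<lambda>k. chi ((T ^^ k) x)) [0..<n]))))"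

lemma trimmed_sum_eq_ordered_sum:
  assumes bij: "bij_betw \<sigma> {1..n} {0..<n}"
    and decr: "\<And>i j. 1 \<le> i \<Longrightarrow> i \<le> j \<Longrightarrow> j \<le> n \<Longrightarrow> chi ((T ^^ \<sigma> j) x) \<le> chi ((T ^^ \<sigma> i) x)"
  shows "trimmed_sum T chi n b x = (\<Sum>k=b+1..n. chi ((T ^^ \<sigma> k) x))"
proof -
  define g where "g = (\<lambda>k. chi ((T ^^ k) x))"
  define ys where "ys = map (\<lambda>k. g (\<sigma> k)) [1..<Suc n]"
  have s: "{Suc 0..<Suc n} = {Suc 0..n}" by auto
  have "mset ys = image_mset g (image_mset \<sigma> (mset_set {1..n}))"
    by (simp add: ys_def image_mset.compositionality comp_def s del: upt_Suc)
  also have "image_mset \<sigma> (mset_set {1..n}) = mset_set {0..<n}"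
    using bij by (metis bij_betw_def image_mset_mset_set)
  finally have m: "mset (rev ys) = mset (map g [0..<n])" by simp
  have "sorted (rev ys)"
    unfolding sorted_wrt_rev sorted_iff_nth_mono ys_def g_def
    by (auto simp: sorted_wrt_iff_nth_less intro!: decr simp del: upt_Suc)
  then have "sort (map g [0..<n]) = rev ys"
    using m by (metis properties_for_sort)
  then have "trimmed_sum T chi n b x = sum_list (drop b ys)"
    by (simp add: trimmed_sum_def g_def)
  also have "drop b ys = map (\<lambda>k. g (\<sigma> k)) [b+1..<Suc n]"
    by (simp add: ys_def drop_map del: upt_Suc)
  also have "sum_list \<dots> = (\<Sum>k=b+1..n. g (\<sigma> k))"
    by (simp add: interv_sum_list_conv_sum_set_nat atLeastLessThanSuc_atLeastAtMost del: upt_Suc)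
  finally show ?thesis by (simp add: g_def)
qed

section \<open>Slow variation\<close>

definition slowly_varying :: "(real \<Rightarrow> real) \<Rightarrow> bool" where
  "slowly_varying L \<longleftrightarrow> (\<forall>c>0. ((\<lambda>x. L (c * x) / L x) \<longlongrightarrow> 1) at_top)"

definition de_Bruijn_conjugate :: "(real \<Rightarrow> real) \<Rightarrow> (real \<Rightarrow> real) \<Rightarrow> bool" where
  "de_Bruijn_conjugate l l' \<longleftrightarrow>
     slowly_varying l' \<and>
     ((\<lambda>x. l x * l' (x * l x)) \<longlongrightarrow> 1) at_top \<and>
     ((\<lambda>x. l' x * l (x * l' x)) \<longlongrightarrow> 1) at_top"

section \<open>Mixing coefficients\<close>

text \<open>The suprema are taken in the extended reals because they may be infinite.\<close>

definition psi_dependence :: "'a measure \<Rightarrow> 'a set set \<Rightarrow> 'a set set \<Rightarrow> ereal" where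
  "psi_dependence M \<B> \<C> =
     Sup {ereal \<bar>measure M (B \<inter> C) / (measure M B * measure M C) - 1\<bar> | B C.
            B \<in> \<B> \<and> C \<in> \<C> \<and> measure M B > 0 \<and> measure M C > 0}"

definition generated_field :: "'a measure \<Rightarrow> (nat \<Rightarrow> 'a \<Rightarrow> real) \<Rightarrow> nat set \<Rightarrow> 'a set set" where
  "generated_field M X J =
     sigma_sets (space M) {X j -` A \<inter> space M | j A. j \<in> J \<and> A \<in> sets borel}"

text \<open>Sequences are indexed from 1; the value of \<open>X\<close> at 0 is not used.\<close>

definition psi_coefficient :: "'a measure \<Rightarrow> (nat \<Rightarrow> 'a \<Rightarrow> real) \<Rightarrow> nat \<Rightarrow> ereal" where
  "psi_coefficient M X n =
     (SUP k\<in>{1..}. psi_dependence M (generated_field M X {1..k}) (generated_field M X {k + n..}))"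

end

theory Submission
  imports Defs
begin

text \<open>Write \<open>p x = \<mu>(\<chi> > x)\<close> and let \<open>N\<^sub>n x\<close> count the \<open>k < n\<close> with \<open>\<chi> \<circ> T\<^sup>k > x\<close>. After the \<open>b\<close>
  largest of the \<open>n\<close> values are removed, exactly \<open>max 0 (N\<^sub>n x - b)\<close> of the remaining ones exceed \<open>x\<close>.
  Hence, by the layer cake formula and Fubini, the expected trimmed sum is the integral of
  \<open>e\<^sub>n x = \<integral> max 0 (N\<^sub>n x - b\<^sub>n) d\<mu>\<close> over the levels \<open>x > 0\<close> (\<open>expectation_trimmed_sum\<close>).

  The relevant scale is \<open>x\<^sub>n = y Lsharp y\<close> with \<open>y = (n / b\<^sub>n) powr (1 / \<alpha>)\<close>: the de Bruijn conjugate is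
  made so that \<open>n p x\<^sub>n / b\<^sub>n\<close> tends to one (\<open>de_Bruijn_inverts_tail\<close>), and
  \<open>d\<^sub>n = \<alpha> / (1 - \<alpha>) b\<^sub>n x\<^sub>n\<close>. With \<open>x = t x\<^sub>n\<close> the claim becomes that the integral of
  \<open>e\<^sub>n (t x\<^sub>n) / b\<^sub>n\<close> over \<open>t > 0\<close> tends to \<open>\<alpha> / (1 - \<alpha>)\<close>, which is the integral of
  \<open>max 0 (t powr (- \<alpha>) - 1)\<close>. This is a dominated convergence argument.

  Pointwise convergence is a law of large numbers: the mean of \<open>N\<^sub>n (t x\<^sub>n) / b\<^sub>n\<close> tends to
  \<open>t powr (- \<alpha>)\<close> by regular variation, and the variance of \<open>N\<^sub>n x\<close> is at most a constant times its mean
  (\<open>exceedances_variance\<close>). The latter comes from the spectral gap: a centred function in the algebra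
  is a coboundary \<open>q - U q\<close> for the transfer operator \<open>U\<close>, with the norm of \<open>q\<close> controlled
  (\<open>centred_is_coboundary\<close>), so the partial sums of the covariances of the indicators telescope.

  For the domination on \<open>t \<le> 1\<close> it is enough to drop \<open>b\<^sub>n\<close> and to bound \<open>p (t x\<^sub>n) / p x\<^sub>n\<close> by
  \<open>C t powr (- \<gamma>)\<close> with \<open>\<gamma> < 1\<close> (\<open>potter_bound_left\<close>). On \<open>t \<ge> 1\<close> the
  mean decays only like \<open>t powr (- \<alpha>)\<close>, which is not integrable, and the variance gives no better decay.
  Here the mixing coefficient enters. As \<open>\<psi>(r) < 1\<close>, joint probabilities over times with gaps of at least \<open>r\<close> are at
  most those of independent events of probability \<open>2 p\<close>, so exponential moments are available and
  \<open>e\<^sub>n x / b\<^sub>n \<le> C (n p x / b\<^sub>n) ^ k\<close> for every fixed \<open>k\<close> and large \<open>b\<^sub>n\<close>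
  (\<open>excess_polynomial_bound\<close>); a large \<open>k\<close> makes this integrable.\<close>

section \<open>Bounded operators on a Banach algebra of functions\<close>

locale function_algebra =
  fixes M :: "'a measure" and F :: "('a \<Rightarrow> complex) set" and nrm :: "('a \<Rightarrow> complex) \<Rightarrow> real"
  assumes algebra: "banach_fun_algebra M F nrm"
begin

lemma measurable_F: "f \<in> F \<Longrightarrow> f \<in> borel_measurable M"
  using algebra unfolding banach_fun_algebra_def by blast

lemma nrm_cong: "f \<in> F \<Longrightarrow> g \<in> borel_measurable M \<Longrightarrow> AE x in M. f x = g x \<Longrightarrow> nrm g = nrm f"
  using algebra unfolding banach_fun_algebra_def by blast

lemma F_zero: "(\<lambda>x. 0) \<in> F"
  using algebra unfolding banach_fun_algebra_def by blast

lemma F_add: "f \<in> F \<Longrightarrow> g \<in> F \<Longrightarrow> (\<lambda>x. f x + g x) \<in> F"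
  using algebra unfolding banach_fun_algebra_def by blast

lemma F_scale: "f \<in> F \<Longrightarrow> (\<lambda>x. c * f x) \<in> F"
  using algebra unfolding banach_fun_algebra_def by blast

lemma F_diff: "f \<in> F \<Longrightarrow> g \<in> F \<Longrightarrow> (\<lambda>x. f x - g x) \<in> F"
  using F_add[of f "\<lambda>x. -1 * g x"] F_scale[of g "-1"] by simp

lemma nrm_nonneg: "f \<in> F \<Longrightarrow> nrm f \<ge> 0"
  using algebra unfolding banach_fun_algebra_def by blast

lemma nrm_eq_0_iff: "f \<in> F \<Longrightarrow> nrm f = 0 \<longleftrightarrow> (AE x in M. f x = 0)"
  using algebra unfolding banach_fun_algebra_def by blast

lemma nrm_add: "f \<in> F \<Longrightarrow> g \<in> F \<Longrightarrow> nrm (\<lambda>x. f x + g x) \<le> nrm f + nrm g"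
  using algebra unfolding banach_fun_algebra_def by blast

lemma nrm_scale: "f \<in> F \<Longrightarrow> nrm (\<lambda>x. c * f x) = cmod c * nrm f"
  using algebra unfolding banach_fun_algebra_def by blast

lemma nrm_diff: "f \<in> F \<Longrightarrow> g \<in> F \<Longrightarrow> nrm (\<lambda>x. f x - g x) \<le> nrm f + nrm g"
  using nrm_add[of f "\<lambda>x. -1 * g x"] F_scale[of g "-1"] nrm_scale[of g "-1"] by simp

lemma nrm_minus_commute:
  assumes "f \<in> F" "g \<in> F"
  shows "nrm (\<lambda>x. f x - g x) = nrm (\<lambda>x. g x - f x)"
  using nrm_scale[OF F_diff[OF assms], of "-1"] by (simp add: algebra_simps)

lemma complete:
  assumes "\<And>n. u n \<in> F" "\<And>e. e > 0 \<Longrightarrow> \<exists>N. \<forall>m\<ge>N. \<forall>n\<ge>N. nrm (\<lambda>x. u m x - u n x) < e"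
  shows "\<exists>f\<in>F. (\<lambda>n. nrm (\<lambda>x. u n x - f x)) \<longlonglongrightarrow> 0"
  using algebra assms unfolding banach_fun_algebra_def by blast

context
  fixes U :: "('a \<Rightarrow> complex) \<Rightarrow> ('a \<Rightarrow> complex)"
  assumes bdd: "bounded_operator M F nrm U"
begin

lemma op_closed: "f \<in> F \<Longrightarrow> U f \<in> F"
  using bdd unfolding bounded_operator_def by blast

lemma op_add: "f \<in> F \<Longrightarrow> g \<in> F \<Longrightarrow> AE x in M. U (\<lambda>x. f x + g x) x = U f x + U g x"
  using bdd unfolding bounded_operator_def by blast

lemma op_scale: "f \<in> F \<Longrightarrow> AE x in M. U (\<lambda>x. c * f x) x = c * U f x"
  using bdd unfolding bounded_operator_def by blast

lemma op_bound: obtains K where "K \<ge> 0" "\<And>f. f \<in> F \<Longrightarrow> nrm (U f) \<le> K * nrm f"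
proof -
  obtain K where K: "\<And>f. f \<in> F \<Longrightarrow> nrm (U f) \<le> K * nrm f"
    using bdd unfolding bounded_operator_def by blast
  have "nrm (U f) \<le> max 0 K * nrm f" if "f \<in> F" for f
    using K[OF that] mult_right_mono[of K "max 0 K" "nrm f"] nrm_nonneg[OF that] by linarith
  then show thesis by (intro that[of "max 0 K"]) auto
qed

lemma op_diff:
  assumes "f \<in> F" "g \<in> F"
  shows "AE x in M. U (\<lambda>x. f x - g x) x = U f x - U g x"
proof -
  have "AE x in M. U (\<lambda>x. f x + -1 * g x) x = U f x + U (\<lambda>x. -1 * g x) x"
    using assms by (intro op_add F_scale)
  moreover have "AE x in M. U (\<lambda>x. -1 * g x) x = -1 * U g x"
    using assms by (intro op_scale)
  ultimately show ?thesis by eventually_elim simp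
qed

lemma op_null:
  assumes "f \<in> F" "AE x in M. f x = 0"
  shows "AE x in M. U f x = 0"
proof -
  obtain K where K: "K \<ge> 0" "\<And>f. f \<in> F \<Longrightarrow> nrm (U f) \<le> K * nrm f"
    using op_bound by blast
  have "nrm (U f) \<le> 0" using K(2)[OF assms(1)] nrm_eq_0_iff[OF assms(1)] assms(2) by simp
  then show ?thesis
    using nrm_nonneg[OF op_closed[OF assms(1)]] nrm_eq_0_iff[OF op_closed[OF assms(1)]] by simp
qed

lemma op_cong:
  assumes "f \<in> F" "g \<in> F" "AE x in M. f x = g x"
  shows "AE x in M. U f x = U g x"
proof -
  have "AE x in M. U (\<lambda>x. f x - g x) x = 0"
    by (rule op_null) (use assms F_diff in auto)
  then show ?thesis using op_diff[OF assms(1,2)] by eventually_elim simp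
qed

text \<open>Outside the disc whose radius bounds the operator, \<open>U g - z g = f\<close> is the fixed point equation
  \<open>g = (U g - f) / z\<close> of a contraction. The iterates are bounded by the geometric series \<open>B\<close>, hence
  shifted iterates are \<open>c^n B\<close> close.\<close>

lemma resolvent_equation_solvable:
  assumes K: "K \<ge> 0" "\<And>f. f \<in> F \<Longrightarrow> nrm (U f) \<le> K * nrm f"
    and z: "cmod z > K" and f: "f \<in> F"
  shows "\<exists>g\<in>F. AE x in M. U g x - z * g x = f x"
proof -
  define S where "S = (\<lambda>g x. (1/z) * (U g x - f x))"
  define u where "u = (\<lambda>n. (S ^^ n) (\<lambda>x. 0))"
  define c where "c = K / cmod z"
  define D where "D = nrm f / cmod z"
  define B where "B = D / (1 - c)"
  have z0: "cmod z > 0" using z K by linarith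
  have c: "0 \<le> c" "c < 1" using K z z0 by (auto simp: c_def)
  have D0: "D \<ge> 0" using nrm_nonneg[OF f] by (simp add: D_def)
  have B0: "B \<ge> 0" and BB: "c * B + D = B" using c D0 by (auto simp: B_def field_simps)
  have SF: "S g \<in> F" if "g \<in> F" for g
    unfolding S_def by (intro F_scale F_diff op_closed that f)
  have u_Suc: "u (Suc n) = S (u n)" for n by (simp add: u_def)
  have uF: "u n \<in> F" for n
    by (induction n) (auto simp: u_def F_zero SF)
  have contr: "nrm (\<lambda>x. S g x - S h x) \<le> c * nrm (\<lambda>x. g x - h x)" if g: "g \<in> F" and h: "h \<in> F" for g h
  proof -
    have "AE x in M. (1/z) * U (\<lambda>x. g x - h x) x = S g x - S h x"
      using op_diff[OF g h] by eventually_elim (simp add: S_def diff_divide_distrib)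
    then have "nrm (\<lambda>x. S g x - S h x) = nrm (\<lambda>x. (1/z) * U (\<lambda>x. g x - h x) x)"
      by (intro nrm_cong F_scale op_closed F_diff g h measurable_F SF)
    also have "\<dots> = cmod (1/z) * nrm (U (\<lambda>x. g x - h x))"
      by (intro nrm_scale op_closed F_diff g h)
    also have "\<dots> \<le> cmod (1/z) * (K * nrm (\<lambda>x. g x - h x))"
      by (intro mult_left_mono K(2) F_diff g h) auto
    finally show ?thesis by (simp add: c_def norm_divide)
  qed
  have bound: "nrm (u n) \<le> B" for n
  proof (induction n)
    case 0
    have "nrm (\<lambda>x. 0) = 0" using nrm_eq_0_iff[OF F_zero] by simp
    then show ?case using B0 by (simp add: u_def)
  next
    case (Suc n)
    have "nrm (u (Suc n)) = cmod (1/z) * nrm (\<lambda>x. U (u n) x - f x)"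
      unfolding u_Suc S_def by (intro nrm_scale F_diff op_closed uF f)
    also have "\<dots> \<le> cmod (1/z) * (K * nrm (u n) + nrm f)"
      using nrm_diff[OF op_closed[OF uF[of n]] f] K(2)[OF uF[of n]]
      by (intro mult_left_mono) auto
    also have "\<dots> = c * nrm (u n) + D" by (simp add: c_def D_def norm_divide add_divide_distrib)
    also have "\<dots> \<le> c * B + D" using Suc c by (intro add_right_mono mult_left_mono)
    finally show ?case using BB by simp
  qed
  have close: "nrm (\<lambda>x. u (n + k) x - u n x) \<le> c ^ n * B" for n k
  proof (induction n)
    case 0
    show ?case using bound[of k] by (simp add: u_def)
  next
    case (Suc n)
    have "nrm (\<lambda>x. u (Suc n + k) x - u (Suc n) x) \<le> c * nrm (\<lambda>x. u (n + k) x - u n x)"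
      using contr[OF uF uF, of "n + k" n] by (simp add: u_Suc)
    also have "\<dots> \<le> c * (c ^ n * B)" using Suc c by (intro mult_left_mono)
    finally show ?case by simp
  qed
  have "\<exists>g\<in>F. (\<lambda>n. nrm (\<lambda>x. u n x - g x)) \<longlonglongrightarrow> 0"
  proof (rule complete)
    fix e :: real assume e: "e > 0"
    have "(\<lambda>n. 2 * c ^ n * B) \<longlonglongrightarrow> 2 * 0 * B"
      by (intro tendsto_intros LIMSEQ_power_zero) (use c in auto)
    then have "eventually (\<lambda>n. 2 * c ^ n * B < e) sequentially"
      using e by (intro order_tendstoD(2)) auto
    then obtain N where N: "2 * c ^ N * B < e" by (auto simp: eventually_sequentially)
    have "nrm (\<lambda>x. u m x - u n x) < e" if "m \<ge> N" "n \<ge> N" for m n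
    proof -
      have "nrm (\<lambda>x. (u m x - u N x) - (u n x - u N x)) \<le> c ^ N * B + c ^ N * B"
        using nrm_diff[OF F_diff[OF uF[of m] uF[of N]] F_diff[OF uF[of n] uF[of N]]]
          close[of N "m - N"] close[of N "n - N"] that by (simp add: algebra_simps)
      then show ?thesis using N by (simp add: algebra_simps)
    qed
    then show "\<exists>N. \<forall>m\<ge>N. \<forall>n\<ge>N. nrm (\<lambda>x. u m x - u n x) < e" by blast
  qed (rule uF)
  then obtain g where g: "g \<in> F" and lim: "(\<lambda>n. nrm (\<lambda>x. u n x - g x)) \<longlonglongrightarrow> 0" by blast
  have "nrm (\<lambda>x. S g x - g x) \<le> 2 * nrm (\<lambda>x. u n x - g x) + nrm (\<lambda>x. u (Suc n) x - g x)" for n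
  proof -
    have "nrm (\<lambda>x. (S g x - S (u n) x) + (u (Suc n) x - g x))
        \<le> nrm (\<lambda>x. S g x - S (u n) x) + nrm (\<lambda>x. u (Suc n) x - g x)"
      by (intro nrm_add F_diff SF g uF)
    moreover have "nrm (\<lambda>x. S g x - S (u n) x) \<le> 1 * nrm (\<lambda>x. g x - u n x)"
      using contr[OF g uF[of n]] mult_right_mono[of c 1 "nrm (\<lambda>x. g x - u n x)"]
        nrm_nonneg[OF F_diff[OF g uF[of n]]] c by linarith
    moreover have "nrm (\<lambda>x. g x - u n x) = nrm (\<lambda>x. u n x - g x)"
      by (intro nrm_minus_commute g uF)
    ultimately show ?thesis
      using nrm_nonneg[OF F_diff[OF uF[of n] g]] by (simp add: u_Suc)
  qed
  moreover have "(\<lambda>n. 2 * nrm (\<lambda>x. u n x - g x) + nrm (\<lambda>x. u (Suc n) x - g x)) \<longlonglongrightarrow> 2 * 0 + 0"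
    by (intro tendsto_intros lim LIMSEQ_Suc[OF lim])
  ultimately have "nrm (\<lambda>x. S g x - g x) \<le> 0"
    by (intro LIMSEQ_le_const) auto
  then have "nrm (\<lambda>x. S g x - g x) = 0" using nrm_nonneg[OF F_diff[OF SF[OF g] g]] by simp
  then have "AE x in M. S g x - g x = 0" using nrm_eq_0_iff[OF F_diff[OF SF[OF g] g]] by simp
  then have "AE x in M. U g x - z * g x = f x"
    by eventually_elim (use z0 in \<open>simp add: S_def field_simps\<close>)
  then show ?thesis using g by blast
qed

text \<open>The spectral radius is a supremum of reals, so it bounds the points of the spectrum only because
  the spectrum is bounded. For \<open>|z| > K\<close> solutions of the resolvent equation are unique, which makes
  any choice of solutions linear.\<close>

lemma spectrum_bounded: "bdd_above (cmod ` operator_spectrum M F nrm U)"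
proof -
  obtain K where K: "K \<ge> 0" "\<And>f. f \<in> F \<Longrightarrow> nrm (U f) \<le> K * nrm f"
    using op_bound by blast
  have "cmod z \<le> K" if "z \<in> operator_spectrum M F nrm U" for z
  proof (rule ccontr)
    assume "\<not> cmod z \<le> K"
    then have z: "cmod z > K" by simp
    define R where "R = (\<lambda>g x. U g x - z * g x)"
    define V where "V = (\<lambda>f. SOME g. g \<in> F \<and> (AE x in M. R g x = f x))"
    have "\<exists>g. g \<in> F \<and> (AE x in M. R g x = f x)" if "f \<in> F" for f
      using resolvent_equation_solvable[OF K z that] by (auto simp: R_def)
    then have V: "V f \<in> F" "AE x in M. R (V f) x = f x" if "f \<in> F" for f
      using someI_ex[of "\<lambda>g. g \<in> F \<and> (AE x in M. R g x = f x)"] that unfolding V_def by blast+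
    have RF: "R g \<in> F" if "g \<in> F" for g
      unfolding R_def by (intro F_diff F_scale op_closed that)
    have lower: "(cmod z - K) * nrm g \<le> nrm (R g)" if g: "g \<in> F" for g
    proof -
      have "nrm (\<lambda>x. z * g x) = nrm (\<lambda>x. U g x - R g x)" by (simp add: R_def)
      also have "\<dots> \<le> nrm (U g) + nrm (R g)" by (intro nrm_diff op_closed RF g)
      finally show ?thesis using nrm_scale[OF g, of z] K(2)[OF g] by (simp add: algebra_simps)
    qed
    have unique: "AE x in M. g x = h x"
      if g: "g \<in> F" and h: "h \<in> F" and eq: "AE x in M. R g x = R h x" for g h
    proof -
      have "AE x in M. R (\<lambda>x. g x - h x) x = 0"
        using op_diff[OF g h] eq unfolding R_def by eventually_elim algebra
      then have "nrm (R (\<lambda>x. g x - h x)) = 0"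
        using nrm_eq_0_iff[OF RF[OF F_diff[OF g h]]] by simp
      then have "(cmod z - K) * nrm (\<lambda>x. g x - h x) \<le> 0"
        using lower[OF F_diff[OF g h]] by simp
      then have "nrm (\<lambda>x. g x - h x) = 0"
        using z nrm_nonneg[OF F_diff[OF g h]] by (simp add: mult_le_0_iff)
      then show ?thesis using nrm_eq_0_iff[OF F_diff[OF g h]] by simp
    qed
    have "bounded_operator M F nrm V"
      unfolding bounded_operator_def
    proof (intro conjI ballI allI)
      fix f assume f: "f \<in> F"
      show "V f \<in> F" by (rule V(1)[OF f])
      fix g assume g: "g \<in> F"
      have "AE x in M. R (V (\<lambda>x. f x + g x)) x = R (\<lambda>x. V f x + V g x) x"
        using V(2)[OF F_add[OF f g]] V(2)[OF f] V(2)[OF g] op_add[OF V(1)[OF f] V(1)[OF g]]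
        by eventually_elim (simp add: R_def algebra_simps)
      from unique[OF _ _ this] show "AE x in M. V (\<lambda>x. f x + g x) x = V f x + V g x"
        by (simp add: V(1) F_add f g)
    next
      fix c f assume f: "f \<in> F"
      have "AE x in M. R (V (\<lambda>x. c * f x)) x = R (\<lambda>x. c * V f x) x"
        using V(2)[OF F_scale[OF f], of c] V(2)[OF f] op_scale[OF V(1)[OF f], of c]
      proof eventually_elim
        case (elim x)
        have "R (\<lambda>x. c * V f x) x = c * R (V f) x" using elim(3) by (simp add: R_def algebra_simps)
        then show ?case using elim by simp
      qed
      from unique[OF _ _ this] show "AE x in M. V (\<lambda>x. c * f x) x = c * V f x"
        by (simp add: V(1) F_scale f)
    next
      have "nrm (V f) \<le> 1 / (cmod z - K) * nrm f" if f: "f \<in> F" for f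
      proof -
        have "nrm f = nrm (R (V f))"
          by (intro nrm_cong[OF RF[OF V(1)]] measurable_F f V(2))
        then show ?thesis using lower[OF V(1)[OF f]] z by (simp add: field_simps)
      qed
      then show "\<exists>K. \<forall>f\<in>F. nrm (V f) \<le> K * nrm f" by blast
    qed
    moreover have "AE x in M. V (\<lambda>y. U f y - z * f y) x = f x" if f: "f \<in> F" for f
    proof (rule unique)
      show "AE x in M. R (V (\<lambda>y. U f y - z * f y)) x = R f x"
        using V(2)[OF RF[OF f]] unfolding R_def .
    qed (use V(1) RF f in \<open>auto simp: R_def\<close>)
    moreover have "AE x in M. U (V f) x - z * V f x = f x" if f: "f \<in> F" for f
      using V(2)[OF f] by (simp add: R_def)
    ultimately show False using that unfolding operator_spectrum_def by blast
  qed
  then show ?thesis by (intro bdd_aboveI[of _ K]) auto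
qed

lemma resolvent_exists:
  assumes "operator_spectral_radius M F nrm U < cmod z"
  obtains V where "bounded_operator M F nrm V"
    "\<And>f. f \<in> F \<Longrightarrow> AE x in M. V (\<lambda>y. U f y - z * f y) x = f x"
    "\<And>f. f \<in> F \<Longrightarrow> AE x in M. U (V f) x - z * V f x = f x"
proof -
  have "z \<notin> operator_spectrum M F nrm U"
    using assms cSup_upper[OF _ spectrum_bounded, of "cmod z"]
    unfolding operator_spectral_radius_def by fastforce
  then show thesis using that unfolding operator_spectrum_def by blast
qed

end

end

section \<open>The transfer operator\<close>

lemma L_infinity_integrable:
  assumes f: "integrable M f" and g: "g \<in> L_infinity M"
  shows "integrable M (\<lambda>x. f x * g x)"
proof -
  obtain C where C: "AE x in M. cmod (g x) \<le> C" and [measurable]: "g \<in> borel_measurable M"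
    using g by (auto simp: L_infinity_def)
  have [measurable]: "f \<in> borel_measurable M" using f by (rule borel_measurable_integrable)
  show ?thesis
  proof (rule Bochner_Integration.integrable_bound)
    show "integrable M (\<lambda>x. complex_of_real C * f x)" by (intro integrable_mult_right f)
    show "AE x in M. cmod (f x * g x) \<le> cmod (complex_of_real C * f x)"
      using C
    proof eventually_elim
      case (elim x)
      then show ?case using mult_left_mono[of "cmod (g x)" "\<bar>C\<bar>" "cmod (f x)"]
        by (simp add: norm_mult mult.commute)
    qed
  qed measurable
qed

lemma L_infinity_compose:
  assumes T: "nonsingular_map M T" and g: "g \<in> L_infinity M"
  shows "(\<lambda>x. g (T x)) \<in> L_infinity M"
proof -
  obtain C where C: "AE x in M. cmod (g x) \<le> C" and gm: "g \<in> borel_measurable M"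
    using g by (auto simp: L_infinity_def)
  have Tm: "T \<in> measurable M M" using T by (simp add: nonsingular_map_def)
  define A where "A = {x \<in> space M. \<not> cmod (g x) \<le> C}"
  have A: "A \<in> sets M" unfolding A_def using gm by measurable
  have "emeasure M A = 0" using C A by (simp add: A_def AE_iff_measurable[OF _ refl])
  then have "T -` A \<inter> space M \<in> null_sets M"
    using T A Tm by (auto simp: nonsingular_map_def null_sets_def)
  then have "AE x in M. x \<notin> T -` A \<inter> space M" by (rule AE_not_in)
  then have "AE x in M. cmod (g (T x)) \<le> C"
    using AE_space by eventually_elim (use measurable_space[OF Tm] in \<open>auto simp: A_def\<close>)
  then show ?thesis using gm Tm by (auto simp: L_infinity_def)
qed

text \<open>For a nonnegative density \<open>f\<close> the transferred function is the Radon-Nikodym derivative of the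
  push-forward of \<open>f \<mu>\<close> under \<open>T\<close>; non-singularity is the absolute continuity that this needs.\<close>

lemma transfer_exists_nonneg:
  fixes f :: "'a \<Rightarrow> real"
  assumes M: "prob_space M" and T: "nonsingular_map M T"
    and f: "integrable M f" and f_nonneg: "\<And>x. f x \<ge> 0"
  shows "\<exists>h. integrable M h \<and> (\<forall>g\<in>L_infinity M.
           (\<integral>x. complex_of_real (h x) * g x \<partial>M) = (\<integral>x. complex_of_real (f x) * g (T x) \<partial>M))"
proof -
  interpret prob_space M by (rule M)
  have Tm [measurable]: "T \<in> measurable M M" using T by (simp add: nonsingular_map_def)
  have fm [measurable]: "f \<in> borel_measurable M" using f by (rule borel_measurable_integrable)
  define N where "N = distr (density M (\<lambda>x. ennreal (f x))) M T"
  have emN: "emeasure N A = (\<integral>\<^sup>+x. ennreal (f x) * indicator (T -` A \<inter> space M) x \<partial>M)"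
    if A: "A \<in> sets M" for A
    using A unfolding N_def by (subst emeasure_distr) (auto simp: emeasure_density)
  have "absolutely_continuous M N"
    unfolding absolutely_continuous_def
  proof
    fix A assume A: "A \<in> null_sets M"
    then have "T -` A \<inter> space M \<in> null_sets M"
      using T Tm by (auto simp: nonsingular_map_def null_sets_def)
    then have "AE x in M. x \<notin> T -` A \<inter> space M" by (rule AE_not_in)
    then have "(\<integral>\<^sup>+x. ennreal (f x) * indicator (T -` A \<inter> space M) x \<partial>M) = (\<integral>\<^sup>+x. 0 \<partial>M)"
      by (intro nn_integral_cong_AE) (auto elim!: eventually_mono split: split_indicator)
    then show "A \<in> null_sets N" using A emN by (auto simp: null_sets_def N_def)
  qed
  then obtain h0 where h0 [measurable]: "h0 \<in> borel_measurable M" and dens: "density M h0 = N"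
    using Radon_Nikodym[of N] by (auto simp: N_def)
  have "(\<integral>\<^sup>+x. h0 x \<partial>M) = emeasure N (space M)"
    unfolding dens[symmetric] by (subst emeasure_density) (auto intro!: nn_integral_cong)
  also have "\<dots> = (\<integral>\<^sup>+x. ennreal (f x) \<partial>M)"
    by (subst emN) (auto intro!: nn_integral_cong split: split_indicator dest: measurable_space[OF Tm])
  also have "\<dots> < \<infinity>" using f f_nonneg by (simp add: integrable_iff_bounded)
  finally have fin: "(\<integral>\<^sup>+x. h0 x \<partial>M) < \<infinity>" .
  then have ae: "AE x in M. ennreal (enn2real (h0 x)) = h0 x"
    using nn_integral_PInf_AE[OF h0] by (auto elim!: eventually_mono simp: less_top)
  define h where "h = (\<lambda>x. enn2real (h0 x))"
  have hm [measurable]: "h \<in> borel_measurable M" unfolding h_def by measurable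
  have h_nonneg: "h x \<ge> 0" for x by (simp add: h_def)
  have "(\<integral>\<^sup>+x. ennreal (h x) \<partial>M) = (\<integral>\<^sup>+x. h0 x \<partial>M)"
    unfolding h_def using ae by (intro nn_integral_cong_AE) auto
  then have "integrable M h"
    using fin h_nonneg by (intro integrableI_bounded) auto
  moreover have dens': "density M (\<lambda>x. ennreal (h x)) = N"
    unfolding dens[symmetric] using ae by (intro density_cong) (auto simp: h_def)
  have "(\<integral>x. complex_of_real (h x) * g x \<partial>M) = (\<integral>x. complex_of_real (f x) * g (T x) \<partial>M)"
    if g: "g \<in> L_infinity M" for g
  proof -
    have [measurable]: "g \<in> borel_measurable M" using g by (auto simp: L_infinity_def)
    have "(\<integral>x. complex_of_real (h x) * g x \<partial>M) = (\<integral>x. g x \<partial>N)"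
      unfolding dens'[symmetric] by (subst integral_density) (auto simp: h_nonneg scaleR_conv_of_real)
    also have "\<dots> = (\<integral>x. g (T x) \<partial>density M (\<lambda>x. ennreal (f x)))"
      unfolding N_def by (subst integral_distr) auto
    also have "\<dots> = (\<integral>x. complex_of_real (f x) * g (T x) \<partial>M)"
      by (subst integral_density) (auto simp: f_nonneg scaleR_conv_of_real)
    finally show ?thesis .
  qed
  ultimately show ?thesis by blast
qed

text \<open>The operator is defined by choice, so its defining relation holds once a witness exists. The
  witness is combined from the positive and negative parts of the real and imaginary part.\<close>

lemma transfer_operator_spec:
  assumes M: "prob_space M" and T: "nonsingular_map M T" and f: "integrable M f"
  shows "integrable M (transfer_operator M T f)"
    and "g \<in> L_infinity M \<Longrightarrow>
           (\<integral>x. transfer_operator M T f x * g x \<partial>M) = (\<integral>x. f x * g (T x) \<partial>M)"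
proof -
  define part where "part = (\<lambda>(i::nat) x. max 0 (if i = 0 then Re (f x) else if i = 1 then - Re (f x)
                          else if i = 2 then Im (f x) else - Im (f x)))"
  define c where "c = (\<lambda>(i::nat). if i = 0 then 1 else if i = 1 then -1 else if i = 2 then \<i> else -\<i>)"
  have part_int: "integrable M (part i)" for i
    unfolding part_def using f
    by (intro integrable_max) (cases "i = 0"; cases "i = 1"; cases "i = 2"; simp)+
  have split: "f x = (\<Sum>i<4. c i * complex_of_real (part i x))" for x
    by (simp add: c_def part_def complex_eq_iff eval_nat_numeral max_def)
  have "\<exists>h. integrable M h \<and> (\<forall>g\<in>L_infinity M.
           (\<integral>x. complex_of_real (h x) * g x \<partial>M) = (\<integral>x. complex_of_real (part i x) * g (T x) \<partial>M))" for i
    by (intro transfer_exists_nonneg M T part_int) (simp add: part_def)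
  then obtain h where h: "\<And>i. integrable M (h i)"
    "\<And>i g. g \<in> L_infinity M \<Longrightarrow>
       (\<integral>x. complex_of_real (h i x) * g x \<partial>M) = (\<integral>x. complex_of_real (part i x) * g (T x) \<partial>M)"
    by metis
  define H where "H = (\<lambda>x. \<Sum>i<(4::nat). c i * complex_of_real (h i x))"
  have "(\<integral>x. H x * g x \<partial>M) = (\<integral>x. f x * g (T x) \<partial>M)" if g: "g \<in> L_infinity M" for g
  proof -
    have "(\<integral>x. H x * g x \<partial>M) = (\<integral>x. (\<Sum>i<4. c i * (complex_of_real (h i x) * g x)) \<partial>M)"
      by (simp add: H_def sum_distrib_right mult.assoc)
    also have "\<dots> = (\<Sum>i<4. c i * (\<integral>x. complex_of_real (h i x) * g x \<partial>M))"
      using h(1) g by (subst Bochner_Integration.integral_sum)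
        (auto intro!: integrable_mult_right L_infinity_integrable)
    also have "\<dots> = (\<Sum>i<4. c i * (\<integral>x. complex_of_real (part i x) * g (T x) \<partial>M))"
      by (simp add: h(2)[OF g])
    also have "\<dots> = (\<integral>x. (\<Sum>i<4. c i * (complex_of_real (part i x) * g (T x))) \<partial>M)"
      using part_int L_infinity_compose[OF T g] by (subst Bochner_Integration.integral_sum)
        (auto intro!: integrable_mult_right L_infinity_integrable)
    also have "\<dots> = (\<integral>x. f x * g (T x) \<partial>M)"
      by (subst split) (simp add: sum_distrib_right mult.assoc)
    finally show ?thesis .
  qed
  moreover have "integrable M H" unfolding H_def using h(1) by auto
  ultimately have "\<exists>h. integrable M h \<and>
     (\<forall>g\<in>L_infinity M. (\<integral>x. h x * g x \<partial>M) = (\<integral>x. f x * g (T x) \<partial>M))" by blast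
  from someI_ex[OF this]
  show "integrable M (transfer_operator M T f)"
    and "g \<in> L_infinity M \<Longrightarrow>
           (\<integral>x. transfer_operator M T f x * g x \<partial>M) = (\<integral>x. f x * g (T x) \<partial>M)"
    unfolding transfer_operator_def by blast+
qed

lemma conjugate_sign_L_infinity:
  assumes [measurable]: "h \<in> borel_measurable M"
  shows "(\<lambda>x. cnj (sgn (h x))) \<in> L_infinity M"
proof -
  have "(\<lambda>x. cnj (sgn (h x))) \<in> borel_measurable M"
    unfolding sgn_div_norm
    by (intro borel_measurable_continuous_on[where f = cnj] continuous_intros) measurable
  moreover have "cmod (cnj (sgn (h x))) \<le> 1" for x by (simp add: norm_sgn)
  ultimately show ?thesis unfolding L_infinity_def by blast
qed

lemma mult_conjugate_sign: "z * cnj (sgn z) = complex_of_real (cmod z)"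
proof (cases "z = 0")
  case False
  have "z * cnj z = complex_of_real (cmod z) * complex_of_real (cmod z)"
    by (simp add: complex_norm_square[symmetric] power2_eq_square)
  then show ?thesis using False
    by (simp add: sgn_div_norm scaleR_conv_of_real field_simps)
qed simp

text \<open>Testing against the conjugate sign of a function recovers its \<open>L\<^sup>1\<close> norm.\<close>

lemma AE_eq_0_if_orthogonal_to_L_infinity:
  assumes h: "integrable M h" and orth: "\<And>g. g \<in> L_infinity M \<Longrightarrow> (\<integral>x. h x * g x \<partial>M) = 0"
  shows "AE x in M. h x = 0"
proof -
  have "complex_of_real (\<integral>x. cmod (h x) \<partial>M) = 0"
    using orth[OF conjugate_sign_L_infinity[of h]] borel_measurable_integrable[OF h]
    by (simp add: mult_conjugate_sign integral_complex_of_real)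
  then have "(\<integral>x. cmod (h x) \<partial>M) = 0" by simp
  then show ?thesis using h by (subst (asm) integral_nonneg_eq_0_iff_AE) auto
qed

text \<open>The transfer operator contracts \<open>L\<^sup>1\<close>, so it has no eigenvalue of modulus above one.\<close>

lemma transfer_operator_eigenvalue:
  assumes M: "prob_space M" and T: "nonsingular_map M T" and h: "integrable M h"
    and eigen: "AE x in M. transfer_operator M T h x = lam * h x" and nz: "\<not> (AE x in M. h x = 0)"
  shows "cmod lam \<le> 1"
proof (rule ccontr)
  assume "\<not> cmod lam \<le> 1"
  then have lam: "cmod lam > 1" by simp
  define g where "g = (\<lambda>x. cnj (sgn (h x)))"
  have [measurable]: "h \<in> borel_measurable M" using h by (rule borel_measurable_integrable)
  have g: "g \<in> L_infinity M" unfolding g_def by (intro conjugate_sign_L_infinity) measurable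
  have [measurable]: "T \<in> measurable M M" using T by (simp add: nonsingular_map_def)
  have g_le: "cmod (g x) \<le> 1" for x by (simp add: g_def norm_sgn)
  have "(\<integral>x. h x * g (T x) \<partial>M) = (\<integral>x. transfer_operator M T h x * g x \<partial>M)"
    by (rule transfer_operator_spec(2)[OF M T h g, symmetric])
  also have "\<dots> = (\<integral>x. lam * complex_of_real (cmod (h x)) \<partial>M)"
  proof (rule integral_cong_AE)
    show "AE x in M. transfer_operator M T h x * g x = lam * complex_of_real (cmod (h x))"
      using eigen by eventually_elim (simp add: g_def mult.assoc mult_conjugate_sign)
    show "(\<lambda>x. transfer_operator M T h x * g x) \<in> borel_measurable M"
      using L_infinity_integrable[OF transfer_operator_spec(1)[OF M T h] g] by auto
  qed measurable
  also have "\<dots> = lam * complex_of_real (\<integral>x. cmod (h x) \<partial>M)"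
    by (simp add: integral_complex_of_real)
  finally have "cmod lam * (\<integral>x. cmod (h x) \<partial>M) = cmod (\<integral>x. h x * g (T x) \<partial>M)"
    by (simp add: norm_mult)
  also have "\<dots> \<le> (\<integral>x. cmod (h x * g (T x)) \<partial>M)" by (rule integral_norm_bound)
  also have "\<dots> \<le> (\<integral>x. cmod (h x) \<partial>M)"
    using integrable_norm[OF L_infinity_integrable[OF h L_infinity_compose[OF T g]]] h
    by (intro integral_mono) (auto simp: norm_mult intro!: mult_left_le g_le)
  finally have "(cmod lam - 1) * (\<integral>x. cmod (h x) \<partial>M) \<le> 0" by (simp add: algebra_simps)
  then have "(\<integral>x. cmod (h x) \<partial>M) = 0"
    using lam Bochner_Integration.integral_nonneg[of M "\<lambda>x. cmod (h x)"]
    by (intro antisym) (auto simp: mult_le_0_iff)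
  then show False using h nz by (subst (asm) integral_nonneg_eq_0_iff_AE) auto
qed

lemma integral_compose_invariant:
  fixes g :: "'a \<Rightarrow> 'b::{banach, second_countable_topology}"
  assumes T: "invariant_measure M T" and [measurable]: "g \<in> borel_measurable M"
  shows "(\<integral>x. g (T x) \<partial>M) = (\<integral>x. g x \<partial>M)"
proof -
  have [measurable]: "T \<in> measurable M M" using T by (simp add: invariant_measure_def)
  have "distr M M T = M"
    by (rule measure_eqI) (use T in \<open>auto simp: emeasure_distr invariant_measure_def\<close>)
  then show ?thesis using integral_distr[of T M M g] by simp
qed

lemma transfer_operator_const_1:
  assumes M: "prob_space M" and T: "nonsingular_map M T" "invariant_measure M T"
  shows "AE x in M. transfer_operator M T (\<lambda>x. 1) x = 1"
proof -
  interpret prob_space M by (rule M)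
  have one: "integrable M (\<lambda>x. 1 :: complex)" by simp
  have "AE x in M. transfer_operator M T (\<lambda>x. 1) x - 1 = 0"
  proof (rule AE_eq_0_if_orthogonal_to_L_infinity)
    show "integrable M (\<lambda>x. transfer_operator M T (\<lambda>x. 1) x - 1)"
      by (intro Bochner_Integration.integrable_diff transfer_operator_spec[OF M T(1)]) auto
    fix g assume g: "g \<in> L_infinity M"
    then have [measurable]: "g \<in> borel_measurable M" by (simp add: L_infinity_def)
    have "(\<integral>x. (transfer_operator M T (\<lambda>x. 1) x - 1) * g x \<partial>M)
        = (\<integral>x. transfer_operator M T (\<lambda>x. 1) x * g x \<partial>M) - (\<integral>x. 1 * g x \<partial>M)"
      unfolding left_diff_distrib
      by (intro Bochner_Integration.integral_diff L_infinity_integrable g transfer_operator_spec[OF M T(1)] one)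
    also have "\<dots> = (\<integral>x. g (T x) \<partial>M) - (\<integral>x. g x \<partial>M)"
      using transfer_operator_spec(2)[OF M T(1) one g] by simp
    also have "\<dots> = 0" using integral_compose_invariant[OF T(2), of g] by simp
    finally show "(\<integral>x. (transfer_operator M T (\<lambda>x. 1) x - 1) * g x \<partial>M) = 0" .
  qed
  then show ?thesis by simp
qed

section \<open>The spectral gap makes centred functions coboundaries\<close>

lemma property_C_bounded:
  assumes C: "property_C M T F nrm" and f: "f \<in> F"
  shows "AE x in M. cmod (f x) \<le> nrm f"
proof -
  have "esssup M (\<lambda>x. ereal (cmod (f x))) \<le> ereal (nrm f)"
    using C f by (auto simp: property_C_def)
  moreover have "AE x in M. ereal (cmod (f x)) \<le> esssup M (\<lambda>x. ereal (cmod (f x)))"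
    by (rule esssup_AE)
  ultimately show ?thesis by (auto elim!: eventually_mono dest: order_trans)
qed

lemma property_C_integrable:
  assumes C: "property_C M T F nrm" and f: "f \<in> F"
  shows "integrable M f"
proof -
  interpret prob_space M using C by (simp add: property_C_def)
  interpret function_algebra M F nrm
    by unfold_locales (use C in \<open>simp add: property_C_def\<close>)
  show ?thesis
    by (rule integrable_const_bound[OF property_C_bounded[OF C f] measurable_F[OF f]])
qed

text \<open>What the gap provides is the inverse of \<open>N - 1\<close>: \<open>\<lambda>\<close> is an eigenvalue of the transfer
  operator, so the spectral radius of \<open>N\<close> is below \<open>|\<lambda>| \<le> 1\<close>. Applied to the fixed function \<open>1\<close>
  this gives \<open>N 1 = 0\<close>, \<open>\<lambda> = 1\<close> and \<open>P 1 = 1\<close>: the image of \<open>P\<close> consists of the constants. For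
  \<open>P f = c\<close> the resolvent solves \<open>f - c = q - N q\<close>, and \<open>P q = 0\<close> turns \<open>N q\<close> into the image of \<open>q\<close>
  under the transfer operator; integration identifies \<open>c\<close>.\<close>

lemma centred_is_coboundary:
  assumes C: "property_C M T F nrm"
  obtains K where "K \<ge> 0"
    "\<And>f. f \<in> F \<Longrightarrow> \<exists>q\<in>F. nrm q \<le> K * nrm f \<and>
       (AE x in M. f x - (\<integral>y. f y \<partial>M) = q x - transfer_operator M T q x)"
proof -
  interpret prob_space M using C by (simp add: property_C_def)
  interpret function_algebra M F nrm
    by unfold_locales (use C in \<open>simp add: property_C_def\<close>)
  define U where "U = transfer_operator M T"
  have M: "prob_space M" and T: "nonsingular_map M T" "invariant_measure M T"
    and const: "\<And>c. (\<lambda>x. c) \<in> F"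
    using C by (auto simp: property_C_def)
  have int: "integrable M f" if "f \<in> F" for f by (rule property_C_integrable[OF C that])
  have gap: "has_spectral_gap M F nrm U" using C by (simp add: property_C_def U_def)
  then obtain lam P N where P: "bounded_operator M F nrm P" and N: "bounded_operator M F nrm N"
    and U: "bounded_operator M F nrm U"
    and dec: "\<And>f. f \<in> F \<Longrightarrow> AE x in M. U f x = lam * P f x + N f x"
    and PP: "\<And>f. f \<in> F \<Longrightarrow> AE x in M. P (P f) x = P f x"
    and one_dim: "one_dim_image M F P"
    and rad: "operator_spectral_radius M F nrm N < cmod lam"
    and PN: "\<And>f. f \<in> F \<Longrightarrow> AE x in M. P (N f) x = 0"
    and NP: "\<And>f. f \<in> F \<Longrightarrow> AE x in M. N (P f) x = 0"
    unfolding has_spectral_gap_def by blast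
  note PF = op_closed[OF P] and NF = op_closed[OF N] and UF = op_closed[OF U]
  obtain h where h: "h \<in> F" "\<not> (AE x in M. h x = 0)"
    and Ph: "\<And>f. f \<in> F \<Longrightarrow> \<exists>c. AE x in M. P f x = c * h x"
    and Ph': "\<And>c. \<exists>f\<in>F. AE x in M. P f x = c * h x"
    using one_dim unfolding one_dim_image_def by blast
  have "cmod lam \<le> 1"
  proof -
    obtain f where f: "f \<in> F" and eq: "AE x in M. P f x = h x" using Ph'[of 1] by auto
    have "AE x in M. U h x = lam * h x"
      using dec[OF h(1)] op_cong[OF P PF[OF f] h(1) eq] op_cong[OF N PF[OF f] h(1) eq]
        PP[OF f] NP[OF f] eq by eventually_elim simp
    then show ?thesis
      unfolding U_def by (intro transfer_operator_eigenvalue[OF M T(1) int[OF h(1)] _ h(2)])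
  qed
  then have "operator_spectral_radius M F nrm N < cmod 1" using rad by simp
  then obtain V where V: "bounded_operator M F nrm V"
    and VN: "\<And>f. f \<in> F \<Longrightarrow> AE x in M. V (\<lambda>y. N f y - 1 * f y) x = f x"
    and NV: "\<And>f. f \<in> F \<Longrightarrow> AE x in M. N (V f) x - 1 * V f x = f x"
    using resolvent_exists[OF N] by blast
  note VF = op_closed[OF V]
  have N_fixed: "AE x in M. f x = 0" if f: "f \<in> F" and eq: "AE x in M. N f x = f x" for f
  proof -
    have "AE x in M. V (\<lambda>y. N f y - 1 * f y) x = 0"
      by (rule op_null[OF V]) (use F_diff[OF NF[OF f] f] eq in auto)
    then show ?thesis using VN[OF f] by eventually_elim simp
  qed
  define e where "e = (\<lambda>x::'a. 1::complex)"
  have e: "e \<in> F" unfolding e_def by (rule const)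
  have Ue: "AE x in M. U e x = e x"
    unfolding U_def e_def by (rule transfer_operator_const_1[OF M T])
  have "AE x in M. N (N e) x = N e x"
  proof -
    have "AE x in M. N e x = N (\<lambda>x. lam * P e x + N e x) x"
      by (rule op_cong[OF N e]) (use F_add[OF F_scale[OF PF[OF e]] NF[OF e]] Ue dec[OF e] in
        \<open>auto elim: eventually_elim2\<close>)
    then show ?thesis
      using op_add[OF N F_scale[OF PF[OF e], of lam] NF[OF e]] op_scale[OF N PF[OF e], of lam] NP[OF e]
      by eventually_elim simp
  qed
  then have Ne: "AE x in M. N e x = 0" by (intro N_fixed NF e)
  have lamPe: "AE x in M. lam * P e x = 1"
    using Ne dec[OF e] Ue by eventually_elim (simp add: e_def)
  have lam: "lam = 1"
  proof -
    have "AE x in M. P e x = P (\<lambda>x. lam * P e x) x"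
      by (rule op_cong[OF P e F_scale[OF PF[OF e]]]) (use lamPe in \<open>auto simp: e_def\<close>)
    then have "AE x in M. lam = 1"
      using op_scale[OF P PF[OF e], of lam] PP[OF e] lamPe by eventually_elim auto
    then show ?thesis by simp
  qed
  have Pe: "AE x in M. P e x = 1" using lamPe lam by simp
  have P_const: "\<exists>c. AE x in M. P f x = c" if f: "f \<in> F" for f
  proof -
    obtain a where a: "AE x in M. P e x = a * h x" using Ph[OF e] by blast
    obtain c where c: "AE x in M. P f x = c * h x" using Ph[OF f] by blast
    have "AE x in M. P f x = c / a"
      using a c Pe
    proof eventually_elim
      case (elim x)
      then have "a * h x = 1" by simp
      then have "h x = 1 / a" by (cases "a = 0") (auto simp: field_simps)
      then show ?case using elim by simp
    qed
    then show ?thesis by blast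
  qed
  obtain KV where KV: "KV \<ge> 0" "\<And>f. f \<in> F \<Longrightarrow> nrm (V f) \<le> KV * nrm f" using op_bound[OF V] by blast
  obtain KP where KP: "KP \<ge> 0" "\<And>f. f \<in> F \<Longrightarrow> nrm (P f) \<le> KP * nrm f" using op_bound[OF P] by blast
  show thesis
  proof (rule that[of "KV * (1 + KP)"])
    show "KV * (1 + KP) \<ge> 0" using KV KP by simp
    fix f assume f: "f \<in> F"
    obtain c where c: "AE x in M. P f x = c" using P_const[OF f] by blast
    define f0 where "f0 = (\<lambda>x. f x - P f x)"
    define q where "q = (\<lambda>x. -1 * V f0 x)"
    have f0: "f0 \<in> F" unfolding f0_def by (intro F_diff PF f)
    have q: "q \<in> F" unfolding q_def by (intro F_scale VF f0)
    have "nrm q = nrm (V f0)" using nrm_scale[OF VF[OF f0], of "-1"] by (simp add: q_def)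
    also have "\<dots> \<le> KV * nrm f0" by (rule KV(2)[OF f0])
    also have "\<dots> \<le> KV * (nrm f + KP * nrm f)"
      using nrm_diff[OF f PF[OF f]] KP(2)[OF f] KV(1) unfolding f0_def
      by (intro mult_left_mono) auto
    finally have nq: "nrm q \<le> KV * (1 + KP) * nrm f" by (simp add: algebra_simps)
    have f0q: "AE x in M. f0 x = q x - N q x"
      using NV[OF f0] op_scale[OF N VF[OF f0], of "-1"]
      unfolding q_def
    proof eventually_elim
      case (elim x)
      show ?case unfolding elim(2) using elim(1) by (simp add: algebra_simps)
    qed
    have Pf0: "AE x in M. P f0 x = 0"
      using op_diff[OF P f PF[OF f]] PP[OF f] unfolding f0_def by eventually_elim simp
    have "AE x in M. P f0 x = P (\<lambda>x. q x - N q x) x"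
      by (rule op_cong[OF P f0 F_diff[OF q NF[OF q]] f0q])
    then have Pq: "AE x in M. P q x = 0"
      using op_diff[OF P q NF[OF q]] PN[OF q] Pf0 by eventually_elim simp
    have cob: "AE x in M. f x - c = q x - U q x"
      using f0q c dec[OF q] Pq by eventually_elim (simp add: f0_def)
    have "(\<integral>x. f x - c \<partial>M) = (\<integral>x. q x - U q x \<partial>M)"
      by (rule integral_cong_AE) (use cob measurable_F[OF f] measurable_F[OF F_diff[OF q UF[OF q]]] in auto)
    also have "\<dots> = (\<integral>x. q x \<partial>M) - (\<integral>x. U q x \<partial>M)"
      by (intro Bochner_Integration.integral_diff int q UF)
    also have "(\<integral>x. U q x \<partial>M) = (\<integral>x. q x \<partial>M)"
      using transfer_operator_spec(2)[OF M T(1) int[OF q], of "\<lambda>x. 1"]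
      by (auto simp: U_def L_infinity_def)
    finally have "(\<integral>x. f x \<partial>M) = c" using int[OF f] by (simp add: prob_space)
    then show "\<exists>q\<in>F. nrm q \<le> KV * (1 + KP) * nrm f \<and>
       (AE x in M. f x - (\<integral>y. f y \<partial>M) = q x - transfer_operator M T q x)"
      using q nq cob by (auto simp: U_def)
  qed
qed

section \<open>Variance of the number of exceedances\<close>

lemma measurable_iterate:
  "T \<in> measurable M M \<Longrightarrow> (T ^^ k) \<in> measurable M M"
  by (induction k) auto

lemma integral_of_bool:
  "(\<integral>\<omega>. of_bool (P \<omega>) \<partial>M) = measure M {\<omega> \<in> space M. P \<omega>}"
proof -
  have "(\<integral>\<omega>. of_bool (P \<omega>) \<partial>M) = (\<integral>\<omega>. indicator {\<omega> \<in> space M. P \<omega>} \<omega> \<partial>M :: real)"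
    by (intro Bochner_Integration.integral_cong refl) (auto simp: indicator_def)
  also have "\<dots> = measure M ({\<omega> \<in> space M. P \<omega>} \<inter> space M)"
    by (rule Bochner_Integration.integral_indicator)
  also have "{\<omega> \<in> space M. P \<omega>} \<inter> space M = {\<omega> \<in> space M. P \<omega>}" by auto
  finally show ?thesis .
qed

lemma integral_iterate_invariant:
  fixes g :: "'a \<Rightarrow> 'b::{banach, second_countable_topology}"
  assumes T: "invariant_measure M T" and g: "g \<in> borel_measurable M"
  shows "(\<integral>x. g ((T ^^ k) x) \<partial>M) = (\<integral>x. g x \<partial>M)"
proof (induction k)
  case (Suc k)
  have Tm: "T \<in> measurable M M" using T by (simp add: invariant_measure_def)
  have "(\<lambda>x. g ((T ^^ k) x)) \<in> borel_measurable M" using g measurable_iterate[OF Tm] by measurable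
  from integral_compose_invariant[OF T this] Suc show ?case
    by (simp add: funpow_swap1)
qed simp

text \<open>With \<open>c k\<close> the covariance at lag \<open>k\<close>, the summand \<open>Z \<circ> T\<^sup>n\<close> adds \<open>c 0 + 2 (c 1 + ... + c n)\<close> to the
  second moment. As \<open>c 0 \<ge> 0\<close>, this is at most twice a partial sum of the covariances.\<close>

lemma stationary_sum_second_moment:
  fixes Z :: "'a \<Rightarrow> real"
  assumes M: "prob_space M" and T: "invariant_measure M T"
    and Z: "Z \<in> borel_measurable M" and bdd: "\<And>x. \<bar>Z x\<bar> \<le> B"
    and cov: "\<And>m. (\<Sum>k<m. \<integral>x. Z x * Z ((T ^^ k) x) \<partial>M) \<le> D"
  shows "(\<integral>x. (\<Sum>i<n. Z ((T ^^ i) x))\<^sup>2 \<partial>M) \<le> 2 * real n * D"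
proof -
  interpret prob_space M by (rule M)
  have Tm: "T \<in> measurable M M" using T by (simp add: invariant_measure_def)
  have [measurable]: "(\<lambda>x. Z ((T ^^ i) x)) \<in> borel_measurable M" for i
    using Z measurable_iterate[OF Tm] by measurable
  define Y where "Y = (\<lambda>n x. \<Sum>i<n. Z ((T ^^ i) x))"
  define c where "c = (\<lambda>k. \<integral>x. Z x * Z ((T ^^ k) x) \<partial>M)"
  have bd: "integrable M f" if "f \<in> borel_measurable M" "\<And>x. \<bar>f x\<bar> \<le> C" for f :: "'a \<Rightarrow> real" and C
    by (rule integrable_const_bound[of _ C]) (use that in auto)
  have B0: "B \<ge> 0" using bdd[of undefined] by linarith
  have bound2: "\<bar>Z x * Z y\<bar> \<le> B * B" for x y
    unfolding abs_mult by (intro mult_mono bdd B0) auto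
  have int2: "integrable M (\<lambda>x. Z ((T ^^ i) x) * Z ((T ^^ j) x))" for i j
    by (rule bd[OF _ bound2]) measurable
  have prod: "(\<integral>x. Z ((T ^^ i) x) * Z ((T ^^ (i + k)) x) \<partial>M) = c k" for i k
  proof -
    have "(T ^^ (i + k)) x = (T ^^ k) ((T ^^ i) x)" for x by (simp add: funpow_add add.commute[of i])
    then have "(\<integral>x. Z ((T ^^ i) x) * Z ((T ^^ (i + k)) x) \<partial>M)
        = (\<integral>x. (\<lambda>y. Z y * Z ((T ^^ k) y)) ((T ^^ i) x) \<partial>M)" by simp
    also have "\<dots> = c k" unfolding c_def
      by (rule integral_iterate_invariant[OF T]) (use Z in measurable)
    finally show ?thesis .
  qed
  have Y_int: "integrable M (\<lambda>x. (Y n x)\<^sup>2)" for n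
    unfolding Y_def power2_eq_square sum_product by (intro Bochner_Integration.integrable_sum int2)
  have "(\<integral>x. (Y n x)\<^sup>2 \<partial>M) \<le> 2 * real n * D"
  proof (induction n)
    case (Suc n)
    have YZ: "integrable M (\<lambda>x. Y n x * Z ((T ^^ n) x))"
      unfolding Y_def sum_distrib_right by (intro Bochner_Integration.integrable_sum int2)
    have "(\<integral>x. Y n x * Z ((T ^^ n) x) \<partial>M) = (\<Sum>i<n. \<integral>x. Z ((T ^^ i) x) * Z ((T ^^ n) x) \<partial>M)"
      unfolding Y_def sum_distrib_right by (intro Bochner_Integration.integral_sum int2)
    also have "\<dots> = (\<Sum>i<n. c (n - i))"
      by (intro sum.cong refl) (use prod in \<open>metis le_add_diff_inverse lessThan_iff less_imp_le\<close>)
    also have "\<dots> = (\<Sum>k<n. c (Suc k))"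
      by (rule sum.reindex_bij_witness[of _ "\<lambda>k. n - Suc k" "\<lambda>k. n - Suc k"]) (auto simp: Suc_diff_Suc)
    also have "c 0 + \<dots> = (\<Sum>k<Suc n. c k)" by (simp add: sum.lessThan_Suc_shift del: sum.lessThan_Suc)
    finally have *: "c 0 + (\<integral>x. Y n x * Z ((T ^^ n) x) \<partial>M) \<le> D" using cov[of "Suc n"]
      by (simp add: c_def)
    have c0: "c 0 \<ge> 0" by (simp add: c_def)
    have "(\<integral>x. (Y (Suc n) x)\<^sup>2 \<partial>M)
        = (\<integral>x. (Y n x)\<^sup>2 + (2 * (Y n x * Z ((T ^^ n) x)) + Z ((T ^^ n) x) * Z ((T ^^ (n + 0)) x)) \<partial>M)"
      by (intro Bochner_Integration.integral_cong refl) (simp add: Y_def power2_eq_square algebra_simps)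
    also have "\<dots> = (\<integral>x. (Y n x)\<^sup>2 \<partial>M) + (2 * (\<integral>x. Y n x * Z ((T ^^ n) x) \<partial>M) + c 0)"
      unfolding prod[of n 0, symmetric] using Y_int YZ int2 by (simp only: Bochner_Integration.integral_add
        Bochner_Integration.integrable_add integrable_mult_right integral_mult_right_zero)
    finally show ?case using Suc * c0 by (simp add: algebra_simps)
  qed (simp add: Y_def)
  then show ?thesis by (simp add: Y_def)
qed

definition exceedances :: "('a \<Rightarrow> 'a) \<Rightarrow> ('a \<Rightarrow> real) \<Rightarrow> nat set \<Rightarrow> real \<Rightarrow> 'a \<Rightarrow> real" where
  "exceedances T chi I x \<omega> = (\<Sum>i\<in>I. of_bool (chi ((T ^^ i) \<omega>) > x))"

text \<open>Writing the centred indicator \<open>f - p\<close> as \<open>q\<close> minus its transfer, the covariance at lag \<open>k\<close> is the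
  difference of \<open>a k = \<integral> q \<cdot> f \<circ> T\<^sup>k\<close> and \<open>a (k + 1)\<close>. The sum telescopes, and \<open>|a k| \<le> |q|\<^sub>\<infinity> p\<close>.\<close>

lemma covariance_sum_bounded:
  assumes D: "property_D M T F nrm chi"
  obtains K where "K \<ge> 0" "\<And>x m. x \<ge> 0 \<Longrightarrow>
    (let p = measure M {\<omega> \<in> space M. chi \<omega> > x}; Z = (\<lambda>\<omega>. of_bool (chi \<omega> > x) - p)
     in (\<Sum>k<m. \<integral>\<omega>. Z \<omega> * Z ((T ^^ k) \<omega>) \<partial>M) \<le> K * p)"
proof -
  have C: "property_C M T F nrm" and [measurable]: "chi \<in> borel_measurable M"
    using D by (auto simp: property_D_def)
  interpret prob_space M using C by (simp add: property_C_def)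
  interpret function_algebra M F nrm
    by unfold_locales (use C in \<open>simp add: property_C_def\<close>)
  have M: "prob_space M" and T: "nonsingular_map M T" "invariant_measure M T"
    using C by (auto simp: property_C_def)
  have Tm [measurable]: "T \<in> measurable M M" using T by (simp add: nonsingular_map_def)
  note [measurable] = measurable_iterate[OF Tm]
  obtain K1 where K1: "K1 > 0" "\<And>l. l \<ge> 0 \<Longrightarrow> (\<lambda>x. complex_of_real (indicator {y. chi y > l} x)) \<in> F"
    "\<And>l. l \<ge> 0 \<Longrightarrow> nrm (\<lambda>x. complex_of_real (indicator {y. chi y > l} x)) \<le> K1"
    using D by (auto simp: property_D_def)
  obtain K where K: "K \<ge> 0"
    "\<And>f. f \<in> F \<Longrightarrow> \<exists>q\<in>F. nrm q \<le> K * nrm f \<and>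
       (AE x in M. f x - (\<integral>y. f y \<partial>M) = q x - transfer_operator M T q x)"
    using centred_is_coboundary[OF C] by blast
  show thesis
  proof (rule that[of "2 * (K * K1)"])
    show "2 * (K * K1) \<ge> 0" using K K1 by simp
    fix x :: real and m assume x: "x \<ge> 0"
    define p where "p = measure M {\<omega> \<in> space M. chi \<omega> > x}"
    define Z where "Z = (\<lambda>\<omega>. of_bool (chi \<omega> > x) - p)"
    define f where "f = (\<lambda>\<omega>. complex_of_real (of_bool (chi \<omega> > x)))"
    have f_eq: "f = (\<lambda>\<omega>. complex_of_real (indicator {y. chi y > x} \<omega>))"
      by (auto simp: f_def indicator_def)
    have f: "f \<in> F" "nrm f \<le> K1" unfolding f_eq by (rule K1(2,3)[OF x])+
    have fm [measurable]: "f \<in> borel_measurable M" by (rule measurable_F[OF f(1)])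
    have f_le: "cmod (f \<omega>) \<le> 1" for \<omega> by (simp add: f_def)
    have fk_L: "(\<lambda>\<omega>. f ((T ^^ k) \<omega>)) \<in> L_infinity M" for k
      using f_le by (auto simp: L_infinity_def)
    have int_real: "(\<integral>\<omega>. of_bool (chi \<omega> > x) \<partial>M) = p"
      unfolding p_def by (rule integral_of_bool)
    have int_f: "(\<integral>\<omega>. f \<omega> \<partial>M) = complex_of_real p"
      unfolding f_def integral_complex_of_real int_real ..
    obtain q where q: "q \<in> F" "nrm q \<le> K * nrm f"
      and cob: "AE y in M. f y - complex_of_real p = q y - transfer_operator M T q y"
      using K(2)[OF f(1)] unfolding int_f by blast
    have qK: "nrm q \<le> K * K1" using q(2) mult_left_mono[OF f(2) K(1)] by linarith
    have q_int: "integrable M q" by (rule property_C_integrable[OF C q(1)])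
    have Uq_int: "integrable M (transfer_operator M T q)" by (rule transfer_operator_spec(1)[OF M T(1) q_int])
    define a where "a = (\<lambda>k. \<integral>\<omega>. q \<omega> * f ((T ^^ k) \<omega>) \<partial>M)"
    have a_bound: "cmod (a k) \<le> K * K1 * p" for k
    proof -
      have "cmod (a k) \<le> (\<integral>\<omega>. cmod (q \<omega> * f ((T ^^ k) \<omega>)) \<partial>M)"
        unfolding a_def by (rule integral_norm_bound)
      also have "\<dots> \<le> (\<integral>\<omega>. K * K1 * of_bool (chi ((T ^^ k) \<omega>) > x) \<partial>M)"
      proof (rule integral_mono_AE)
        show "integrable M (\<lambda>\<omega>. cmod (q \<omega> * f ((T ^^ k) \<omega>)))"
          by (intro integrable_norm L_infinity_integrable[OF q_int fk_L])
        show "integrable M (\<lambda>\<omega>. K * K1 * of_bool (chi ((T ^^ k) \<omega>) > x) :: real)"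
          by (rule integrable_const_bound[of _ "K * K1"]) (use K K1 in auto)
        show "AE \<omega> in M. cmod (q \<omega> * f ((T ^^ k) \<omega>)) \<le> K * K1 * of_bool (chi ((T ^^ k) \<omega>) > x)"
          using property_C_bounded[OF C q(1)]
          by eventually_elim (use qK in \<open>auto simp: f_def norm_mult\<close>)
      qed
      also have "\<dots> = K * K1 * (\<integral>\<omega>. (\<lambda>y. of_bool (chi y > x)) ((T ^^ k) \<omega>) \<partial>M)" by simp
      also have "\<dots> = K * K1 * p"
        by (subst integral_iterate_invariant[OF T(2)]) (auto simp: int_real)
      finally show ?thesis .
    qed
    have cov: "(\<integral>\<omega>. Z \<omega> * Z ((T ^^ k) \<omega>) \<partial>M) = Re (a k - a (Suc k))" for k
    proof -
      have Zb: "integrable M (\<lambda>\<omega>. Z \<omega> * of_bool (chi ((T ^^ k) \<omega>) > x))" "integrable M Z"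
        by (rule integrable_const_bound[of _ "1 + \<bar>p\<bar>"]; auto simp: Z_def)+
      have "(\<integral>\<omega>. Z \<omega> \<partial>M) = 0" unfolding Z_def
        by (subst Bochner_Integration.integral_diff)
          (auto simp: int_real prob_space intro!: integrable_const_bound[of _ 1])
      moreover have "(\<integral>\<omega>. Z \<omega> * Z ((T ^^ k) \<omega>) \<partial>M)
          = (\<integral>\<omega>. Z \<omega> * of_bool (chi ((T ^^ k) \<omega>) > x) - p * Z \<omega> \<partial>M)"
        by (intro Bochner_Integration.integral_cong refl) (simp add: Z_def algebra_simps)
      ultimately have "(\<integral>\<omega>. Z \<omega> * Z ((T ^^ k) \<omega>) \<partial>M) = (\<integral>\<omega>. Z \<omega> * of_bool (chi ((T ^^ k) \<omega>) > x) \<partial>M)"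
        using Zb by simp
      also have "complex_of_real \<dots> = (\<integral>\<omega>. (f \<omega> - complex_of_real p) * f ((T ^^ k) \<omega>) \<partial>M)"
        unfolding integral_complex_of_real[symmetric]
        by (intro Bochner_Integration.integral_cong refl) (simp add: Z_def f_def)
      also have "\<dots> = (\<integral>\<omega>. q \<omega> * f ((T ^^ k) \<omega>) - transfer_operator M T q \<omega> * f ((T ^^ k) \<omega>) \<partial>M)"
      proof (rule integral_cong_AE)
        show "AE \<omega> in M. (f \<omega> - complex_of_real p) * f ((T ^^ k) \<omega>)
            = q \<omega> * f ((T ^^ k) \<omega>) - transfer_operator M T q \<omega> * f ((T ^^ k) \<omega>)"
          using cob by eventually_elim (simp add: left_diff_distrib)
        show "(\<lambda>\<omega>. q \<omega> * f ((T ^^ k) \<omega>) - transfer_operator M T q \<omega> * f ((T ^^ k) \<omega>)) \<in> borel_measurable M"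
          using L_infinity_integrable[OF q_int fk_L] L_infinity_integrable[OF Uq_int fk_L]
          by (intro borel_measurable_diff) auto
      qed measurable
      also have "\<dots> = a k - (\<integral>\<omega>. transfer_operator M T q \<omega> * f ((T ^^ k) \<omega>) \<partial>M)"
        unfolding a_def
        by (intro Bochner_Integration.integral_diff L_infinity_integrable q_int Uq_int fk_L)
      also have "(\<integral>\<omega>. transfer_operator M T q \<omega> * f ((T ^^ k) \<omega>) \<partial>M) = a (Suc k)"
        unfolding a_def transfer_operator_spec(2)[OF M T(1) q_int fk_L] by (simp add: funpow_swap1)
      finally show ?thesis by (metis Re_complex_of_real)
    qed
    have "(\<Sum>k<m. \<integral>\<omega>. Z \<omega> * Z ((T ^^ k) \<omega>) \<partial>M) = Re (\<Sum>k<m. a k - a (Suc k))"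
      unfolding cov by simp
    also have "\<dots> = Re (a 0 - a m)" by (simp add: sum_lessThan_telescope')
    also have "\<dots> \<le> cmod (a 0) + cmod (a m)"
      using complex_Re_le_cmod[of "a 0 - a m"] norm_triangle_ineq4[of "a 0" "a m"] by linarith
    also have "\<dots> \<le> 2 * (K * K1) * p" using a_bound[of 0] a_bound[of m] by simp
    finally show "let p = measure M {\<omega> \<in> space M. chi \<omega> > x}; Z = (\<lambda>\<omega>. of_bool (chi \<omega> > x) - p)
     in (\<Sum>k<m. \<integral>\<omega>. Z \<omega> * Z ((T ^^ k) \<omega>) \<partial>M) \<le> 2 * (K * K1) * p"
      unfolding Let_def Z_def p_def .
  qed
qed

lemma exceedances_variance:
  assumes D: "property_D M T F nrm chi"
  obtains K where "K \<ge> 0" "\<And>x n. x \<ge> 0 \<Longrightarrow>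
    (\<integral>\<omega>. (exceedances T chi {..<n} x \<omega> - real n * measure M {\<omega> \<in> space M. chi \<omega> > x})\<^sup>2 \<partial>M)
      \<le> K * (real n * measure M {\<omega> \<in> space M. chi \<omega> > x})"
proof -
  have C: "property_C M T F nrm" and [measurable]: "chi \<in> borel_measurable M"
    using D by (auto simp: property_D_def)
  have M: "prob_space M" and T: "invariant_measure M T"
    using C by (auto simp: property_C_def)
  interpret prob_space M by (rule M)
  obtain K where K: "K \<ge> 0" "\<And>x m. x \<ge> 0 \<Longrightarrow>
    (let p = measure M {\<omega> \<in> space M. chi \<omega> > x}; Z = (\<lambda>\<omega>. of_bool (chi \<omega> > x) - p)
     in (\<Sum>k<m. \<integral>\<omega>. Z \<omega> * Z ((T ^^ k) \<omega>) \<partial>M) \<le> K * p)"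
    using covariance_sum_bounded[OF D] by blast
  show thesis
  proof (rule that[of "2 * K"])
    show "2 * K \<ge> 0" using K by simp
    fix x :: real and n assume x: "x \<ge> 0"
    define p where "p = measure M {\<omega> \<in> space M. chi \<omega> > x}"
    define Z where "Z = (\<lambda>\<omega>. of_bool (chi \<omega> > x) - p)"
    have "(\<integral>\<omega>. (\<Sum>i<n. Z ((T ^^ i) \<omega>))\<^sup>2 \<partial>M) \<le> 2 * real n * (K * p)"
    proof (rule stationary_sum_second_moment[OF M T])
      show "\<bar>Z \<omega>\<bar> \<le> 1" for \<omega> using prob_le_1 by (auto simp: Z_def p_def)
      show "(\<Sum>k<m. \<integral>\<omega>. Z \<omega> * Z ((T ^^ k) \<omega>) \<partial>M) \<le> K * p" for m
        using K(2)[OF x, of m] unfolding Let_def p_def Z_def .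
    qed (simp add: Z_def)
    moreover have "(\<Sum>i<n. Z ((T ^^ i) \<omega>)) = exceedances T chi {..<n} x \<omega> - real n * p" for \<omega>
      by (simp add: Z_def exceedances_def sum_subtractf)
    ultimately show "(\<integral>\<omega>. (exceedances T chi {..<n} x \<omega> - real n * measure M {\<omega> \<in> space M. chi \<omega> > x})\<^sup>2 \<partial>M)
      \<le> 2 * K * (real n * measure M {\<omega> \<in> space M. chi \<omega> > x})"
      by (simp add: p_def mult_ac)
  qed
qed

section \<open>Excess of the number of exceedances over a high level\<close>

lemma generated_field_measurable:
  assumes "\<And>j. j \<in> J \<Longrightarrow> X j \<in> borel_measurable M"
  shows "generated_field M X J \<subseteq> sets M"
  unfolding generated_field_def
  by (rule sets.sigma_sets_subset) (use assms in \<open>auto intro: measurable_sets\<close>)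

lemma generated_field_ball:
  assumes "finite S" "\<And>i. i \<in> S \<Longrightarrow> Suc i \<in> J"
  shows "{\<omega> \<in> space M. \<forall>i\<in>S. X (Suc i) \<omega> > x} \<in> generated_field M X J"
proof -
  define G where "G = {X j -` A \<inter> space M | j A. j \<in> J \<and> A \<in> sets borel}"
  have G: "G \<subseteq> Pow (space M)" by (auto simp: G_def)
  have "{\<omega> \<in> space (sigma (space M) G). \<forall>i\<in>S. X (Suc i) \<omega> > x} \<in> sets (sigma (space M) G)"
  proof (rule sets.sets_Collect_finite_All[OF _ assms(1)])
    fix i assume "i \<in> S"
    then have "{\<omega> \<in> space M. X (Suc i) \<omega> > x} \<in> G"
      using assms(2) by (auto simp: G_def intro!: exI[of _ "Suc i"] exI[of _ "{x<..}"])
    then show "{\<omega> \<in> space (sigma (space M) G). X (Suc i) \<omega> > x} \<in> sets (sigma (space M) G)"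
      using G by (auto simp: space_measure_of)
  qed
  then show ?thesis using G by (simp add: generated_field_def G_def[symmetric])
qed

text \<open>The deviation of the ratio from one is below one, so the ratio is at most two.\<close>

lemma psi_coefficient_product_bound:
  assumes M: "prob_space M" and X: "\<And>j. X j \<in> borel_measurable M"
    and psi: "psi_coefficient M X r < 1" and k: "k \<ge> 1"
    and B: "B \<in> generated_field M X {1..k}" and C: "C \<in> generated_field M X {k + r..}"
  shows "measure M (B \<inter> C) \<le> 2 * measure M B * measure M C"
proof -
  interpret prob_space M by (rule M)
  have sets: "B \<in> sets M" "C \<in> sets M"
    using B C generated_field_measurable[of _ X M] X by blast+
  show ?thesis
  proof (cases "measure M B > 0 \<and> measure M C > 0")
    case True
    have "ereal \<bar>measure M (B \<inter> C) / (measure M B * measure M C) - 1\<bar>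
        \<le> psi_dependence M (generated_field M X {1..k}) (generated_field M X {k + r..})"
      unfolding psi_dependence_def by (rule Sup_upper) (use B C True in blast)
    also have "\<dots> \<le> psi_coefficient M X r"
      unfolding psi_coefficient_def by (rule SUP_upper) (use k in auto)
    finally have "ereal \<bar>measure M (B \<inter> C) / (measure M B * measure M C) - 1\<bar> < 1"
      using psi by (rule order_le_less_trans)
    then have "measure M (B \<inter> C) / (measure M B * measure M C) \<le> 2" by simp
    then show ?thesis using True by (simp add: field_simps)
  next
    case False
    then have "measure M B = 0 \<or> measure M C = 0"
      using measure_nonneg[of M B] measure_nonneg[of M C] by linarith
    then show ?thesis
      using finite_measure_mono[of "B \<inter> C" B] finite_measure_mono[of "B \<inter> C" C] sets by auto
  qed
qed

locale psi_mixing_observable = prob_space M for M :: "'a measure" +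
  fixes T :: "'a \<Rightarrow> 'a" and chi :: "'a \<Rightarrow> real" and r :: nat
  assumes invariant: "invariant_measure M T"
    and chi_measurable: "chi \<in> borel_measurable M"
    and psi: "psi_coefficient M (\<lambda>n x. chi ((T ^^ (n - 1)) x)) r < 1"
    and r_pos: "r \<ge> 1"
begin

lemma iterate_measurable [measurable]: "(\<lambda>\<omega>. chi ((T ^^ i) \<omega>)) \<in> borel_measurable M"
  using chi_measurable measurable_iterate[of T M i] invariant
  by (auto simp: invariant_measure_def)

lemma exceedances_measurable [measurable]: "exceedances T chi I x \<in> borel_measurable M"
  unfolding exceedances_def by measurable

abbreviation tail_prob :: "real \<Rightarrow> real" where
  "tail_prob x \<equiv> measure M {\<omega> \<in> space M. chi \<omega> > x}"

lemma tail_prob_iterate: "measure M {\<omega> \<in> space M. chi ((T ^^ i) \<omega>) > x} = tail_prob x"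
proof -
  have [measurable]: "chi \<in> borel_measurable M" by (rule chi_measurable)
  have "(\<integral>\<omega>. (\<lambda>y. of_bool (chi y > x) :: real) ((T ^^ i) \<omega>) \<partial>M) = (\<integral>\<omega>. of_bool (chi \<omega> > x) \<partial>M)"
    by (rule integral_iterate_invariant[OF invariant]) measurable
  then show ?thesis by (simp only: integral_of_bool)
qed

text \<open>The latest index is separated by \<open>r\<close> from all others, so it contributes at most the factor
  \<open>2 p\<close>.\<close>

lemma joint_exceedance_bound:
  assumes "finite S" "\<And>i j. i \<in> S \<Longrightarrow> j \<in> S \<Longrightarrow> i < j \<Longrightarrow> i + r \<le> j"
  shows "measure M {\<omega> \<in> space M. \<forall>i\<in>S. chi ((T ^^ i) \<omega>) > x} \<le> (2 * tail_prob x) ^ card S"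
  using assms
proof (induction S rule: finite_linorder_max_induct)
  case empty
  then show ?case by (simp add: prob_space)
next
  case (insert m A)
  define X where "X = (\<lambda>n \<omega>. chi ((T ^^ (n - 1)) \<omega>))"
  define E where "E = (\<lambda>S. {\<omega> \<in> space M. \<forall>i\<in>S. X (Suc i) \<omega> > x})"
  have E_eq: "E S = {\<omega> \<in> space M. \<forall>i\<in>S. chi ((T ^^ i) \<omega>) > x}" for S
    by (simp add: E_def X_def)
  have IH: "measure M (E A) \<le> (2 * tail_prob x) ^ card A"
    unfolding E_eq by (rule insert.IH) (use insert.prems in auto)
  have single: "measure M (E {m}) = tail_prob x"
    unfolding E_eq by (simp add: tail_prob_iterate)
  have "measure M (E (insert m A)) \<le> 2 * measure M (E A) * measure M (E {m})"
  proof (cases "A = {}")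
    case True
    then show ?thesis by (simp add: E_def prob_space)
  next
    case False
    define k where "k = Suc (Max A)"
    have maxA: "Max A \<in> A" "\<And>a. a \<in> A \<Longrightarrow> a \<le> Max A" using False insert.hyps by auto
    have "E A \<in> generated_field M X {1..k}"
      unfolding E_def by (rule generated_field_ball) (use insert.hyps maxA in \<open>auto simp: k_def\<close>)
    moreover have "E {m} \<in> generated_field M X {k + r..}"
      unfolding E_def by (rule generated_field_ball)
        (use insert.hyps maxA insert.prems[of "Max A" m] in \<open>auto simp: k_def\<close>)
    moreover have "X j \<in> borel_measurable M" for j unfolding X_def by measurable
    ultimately have "measure M (E A \<inter> E {m}) \<le> 2 * measure M (E A) * measure M (E {m})"
      using psi_coefficient_product_bound[OF prob_space_axioms, of X r k] psi
      by (simp add: X_def k_def)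
    moreover have "E A \<inter> E {m} = E (insert m A)" by (auto simp: E_def)
    ultimately show ?thesis by simp
  qed
  also have "\<dots> \<le> 2 * (2 * tail_prob x) ^ card A * tail_prob x"
    unfolding single using IH by (intro mult_right_mono mult_left_mono) auto
  also have "\<dots> = (2 * tail_prob x) ^ card (insert m A)"
    using insert.hyps by (subst card_insert_disjoint) (auto simp: algebra_simps)
  finally show ?case unfolding E_eq .
qed

text \<open>Expanding the product over subsets reduces the exponential moment to joint probabilities; the
  resulting bound is that of independent events of probability \<open>2 p\<close>.\<close>

lemma separated_exponential_moment:
  assumes I: "finite I" "\<And>i j. i \<in> I \<Longrightarrow> j \<in> I \<Longrightarrow> i < j \<Longrightarrow> i + r \<le> j" and s: "s \<ge> 0"
  shows "(\<integral>\<omega>. (1 + s) powr exceedances T chi I x \<omega> \<partial>M) \<le> exp (2 * s * tail_prob x * card I)"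
proof -
  define A where "A = (\<lambda>i \<omega>. of_bool (chi ((T ^^ i) \<omega>) > x) :: real)"
  have [measurable]: "A i \<in> borel_measurable M" for i unfolding A_def by measurable
  have prodA: "(\<Prod>i\<in>S. A i \<omega>) = of_bool (\<forall>i\<in>S. chi ((T ^^ i) \<omega>) > x)" if "finite S" for S \<omega>
    using that by (induction S rule: finite_induct) (auto simp: A_def)
  have expand: "(1 + s) powr exceedances T chi I x \<omega>
      = (\<Sum>S\<in>Pow I. s ^ card S * of_bool (\<forall>i\<in>S. chi ((T ^^ i) \<omega>) > x))" for \<omega>
  proof -
    have "(1 + s) powr exceedances T chi I x \<omega> = (\<Prod>i\<in>I. (1 + s) powr A i \<omega>)"
      unfolding exceedances_def A_def using s by (intro powr_sum I(1)) auto
    also have "\<dots> = (\<Prod>i\<in>I. s * A i \<omega> + 1)"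
      using s by (intro prod.cong refl) (auto simp: A_def)
    also have "\<dots> = (\<Sum>S\<in>Pow I. s ^ card S * (\<Prod>i\<in>S. A i \<omega>))"
      by (subst prod_add[OF I(1)]) (simp add: prod.distrib)
    also have "\<dots> = (\<Sum>S\<in>Pow I. s ^ card S * of_bool (\<forall>i\<in>S. chi ((T ^^ i) \<omega>) > x))"
      by (intro sum.cong refl) (use prodA I(1) in \<open>auto dest: finite_subset\<close>)
    finally show ?thesis .
  qed
  have "(\<integral>\<omega>. (1 + s) powr exceedances T chi I x \<omega> \<partial>M)
      = (\<Sum>S\<in>Pow I. s ^ card S * measure M {\<omega> \<in> space M. \<forall>i\<in>S. chi ((T ^^ i) \<omega>) > x})"
    unfolding expand
  proof (subst Bochner_Integration.integral_sum)
    fix S assume "S \<in> Pow I"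
    then have "finite S" using I(1) by (auto dest: finite_subset)
    then have "(\<lambda>\<omega>. of_bool (\<forall>i\<in>S. chi ((T ^^ i) \<omega>) > x) :: real) \<in> borel_measurable M"
      unfolding prodA[symmetric] by measurable
    then show "integrable M (\<lambda>\<omega>. s ^ card S * of_bool (\<forall>i\<in>S. chi ((T ^^ i) \<omega>) > x))"
      by (intro integrable_mult_right integrable_const_bound[of _ 1]) auto
  qed (simp add: integral_of_bool)
  also have "\<dots> \<le> (\<Sum>S\<in>Pow I. s ^ card S * (2 * tail_prob x) ^ card S)"
  proof (intro sum_mono mult_left_mono)
    fix S assume S: "S \<in> Pow I"
    then have "finite S" using I(1) by (auto dest: finite_subset)
    then show "measure M {\<omega> \<in> space M. \<forall>i\<in>S. chi ((T ^^ i) \<omega>) > x} \<le> (2 * tail_prob x) ^ card S"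
      by (rule joint_exceedance_bound) (use S I(2) in auto)
  qed (use s in auto)
  also have "\<dots> = (\<Prod>i\<in>I. s * (2 * tail_prob x) + 1)"
    by (subst prod_add[OF I(1)]) (simp add: power_mult_distrib)
  also have "\<dots> \<le> (\<Prod>i\<in>I. exp (2 * s * tail_prob x))"
    by (intro prod_mono) (use s exp_ge_add_one_self[of "2 * s * tail_prob x"] in \<open>auto simp: algebra_simps\<close>)
  also have "\<dots> = exp (2 * s * tail_prob x * card I)"
    by (simp add: exp_of_nat_mult[symmetric] mult_ac)
  finally show ?thesis .
qed

lemma exceedances_integrable: "finite I \<Longrightarrow> integrable M (exceedances T chi I x)"
  unfolding exceedances_def
  by (intro Bochner_Integration.integrable_sum integrable_const_bound[of _ 1]) auto

lemma exceedances_bounds: "0 \<le> exceedances T chi I x \<omega>" "exceedances T chi I x \<omega> \<le> card I"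
proof -
  show "0 \<le> exceedances T chi I x \<omega>" unfolding exceedances_def by (rule sum_nonneg) auto
  have "exceedances T chi I x \<omega> \<le> (\<Sum>i\<in>I. 1)" unfolding exceedances_def by (rule sum_mono) auto
  then show "exceedances T chi I x \<omega> \<le> card I" by simp
qed

lemma excess_integrable: "finite I \<Longrightarrow> integrable M (\<lambda>\<omega>. max 0 (exceedances T chi I x \<omega> - a))"
  by (intro integrable_max Bochner_Integration.integrable_diff exceedances_integrable) auto

text \<open>Chernoff's method: \<open>max 0 (y - a) \<le> \<lambda> powr (y - a) / ln \<lambda>\<close>. Here \<open>a u\<close> bounds the expected
  number of exceedances, and \<open>\<lambda> = 1 + 1 / u\<close> keeps the exponential moment below \<open>exp (2 a)\<close> while
  \<open>\<lambda> powr (- a)\<close> is at most \<open>u powr a\<close>.\<close>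

lemma separated_excess_bound:
  assumes I: "finite I" "\<And>i j. i \<in> I \<Longrightarrow> j \<in> I \<Longrightarrow> i < j \<Longrightarrow> i + r \<le> j"
    and a: "a > 0" and u: "u > 0" "u \<le> 1" "card I * tail_prob x \<le> a * u"
  shows "(\<integral>\<omega>. max 0 (exceedances T chi I x \<omega> - a) \<partial>M) \<le> 2 * (exp 2 * u) powr a"
proof -
  define lam where "lam = 1 + 1 / u"
  have lam: "lam \<ge> 2" using u by (simp add: lam_def)
  have ln_lam: "ln lam \<ge> 1/2"
    using ln2_ge_two_thirds ln_mono[of 2 lam] lam by linarith
  have powr_int: "integrable M (\<lambda>\<omega>. lam powr exceedances T chi I x \<omega>)"
  proof (rule integrable_const_bound)
    show "AE \<omega> in M. norm (lam powr exceedances T chi I x \<omega>) \<le> lam powr card I"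
      using lam exceedances_bounds by (auto intro!: powr_mono)
  qed measurable
  have pointwise: "max 0 (y - a) \<le> 2 * lam powr (- a) * lam powr y" for y :: real
  proof -
    have "2 * lam powr (- a) * lam powr y = 2 * exp ((y - a) * ln lam)"
      using lam by (simp add: powr_def exp_add[symmetric] algebra_simps)
    moreover have "2 * exp ((y - a) * ln lam) \<ge> 2 * (1 + (y - a) * ln lam)"
      by (intro mult_left_mono exp_ge_add_one_self) auto
    moreover have "y - a \<le> 2 * ((y - a) * ln lam)" if "y \<ge> a"
      using mult_left_mono[OF ln_lam, of "y - a"] that by simp
    ultimately show ?thesis by (cases "y \<ge> a") (auto simp: max_def)
  qed
  have "(\<integral>\<omega>. max 0 (exceedances T chi I x \<omega> - a) \<partial>M)
      \<le> (\<integral>\<omega>. 2 * lam powr (- a) * lam powr exceedances T chi I x \<omega> \<partial>M)"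
    by (intro integral_mono excess_integrable I(1) integrable_mult_right powr_int pointwise)
  also have "\<dots> \<le> 2 * lam powr (- a) * exp (2 * (1/u) * tail_prob x * card I)"
    using separated_exponential_moment[OF I, of "1/u" x] u
    by (simp add: lam_def mult_left_mono)
  also have "\<dots> \<le> 2 * (1/u) powr (- a) * exp (2 * a)"
  proof (intro mult_mono)
    show "lam powr (- a) \<le> (1/u) powr (- a)"
      using a u by (intro powr_mono2') (auto simp: lam_def)
    show "exp (2 * (1/u) * tail_prob x * card I) \<le> exp (2 * a)"
      using u by (simp add: field_simps)
  qed auto
  also have "\<dots> = 2 * (exp 2 * u) powr a"
    using u by (simp add: powr_mult powr_divide powr_minus exp_powr_real field_simps)
  finally show ?thesis .
qed

lemma exceedances_expectation: "(\<integral>\<omega>. exceedances T chi {..<n} x \<omega> \<partial>M) = n * tail_prob x"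
  unfolding exceedances_def
  by (subst Bochner_Integration.integral_sum)
    (auto simp: integral_of_bool tail_prob_iterate intro!: integrable_const_bound[of _ 1])

text \<open>The residue classes modulo \<open>r\<close> are \<open>r\<close>-separated, and an excess of the total over \<open>b\<close> is at most the
  sum of the excesses of the classes over \<open>b / r\<close>. Once the expected number of exceedances is a small
  multiple of \<open>b\<close>, the Chernoff bound has exponent \<open>b / r \<ge> k\<close>; otherwise the expectation
  itself is a sufficient bound.\<close>

lemma excess_polynomial_bound:
  assumes k: "k \<ge> 1"
  obtains C where "C > 0" "\<And>n b x. b \<ge> r * k \<Longrightarrow>
    (\<integral>\<omega>. max 0 (exceedances T chi {..<n} x \<omega> - real b) \<partial>M) \<le> C * b * (n * tail_prob x / b) ^ k"
proof -
  define \<kappa> where "\<kappa> = 1 / (exp 2 * real r)"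
  have e2: "exp 2 * real r \<ge> 1" using r_pos mult_mono[of 1 "exp (2::real)" 1 "real r"] by simp
  have \<kappa>: "\<kappa> > 0" "\<kappa> \<le> 1" using r_pos e2 by (auto simp: \<kappa>_def)
  define C where "C = 2 * real r * (1 / \<kappa>) ^ k"
  have C: "C > 0" using r_pos \<kappa> by (simp add: C_def)
  show thesis
  proof (rule that[OF C])
    fix n b :: nat and x :: real assume b: "b \<ge> r * k"
    define p where "p = tail_prob x"
    define v where "v = n * p / b"
    have b1: "b \<ge> 1" using b k r_pos by (meson mult_le_mono order_trans le_square one_le_mult_iff)
    have v0: "v \<ge> 0" by (simp add: v_def p_def)
    let ?E = "\<lambda>I a. (\<integral>\<omega>. max 0 (exceedances T chi I x \<omega> - a) \<partial>M)"
    show "?E {..<n} (real b) \<le> C * b * (n * tail_prob x / b) ^ k"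
    proof (cases "0 < v \<and> v \<le> \<kappa>")
      case True
      define I where "I = (\<lambda>j. {i \<in> {..<n}. i mod r = j})"
      define a where "a = real b / real r"
      have a: "a > 0" "a \<ge> k"
        using b b1 r_pos by (auto simp: a_def field_simps simp flip: of_nat_mult)
      have sep: "i + r \<le> i'" if "i \<in> I j" "i' \<in> I j" "i < i'" for i i' j
      proof -
        have "r dvd i' - i" using that mod_eq_dvd_iff_nat[of i i' r] by (auto simp: I_def)
        then show ?thesis using that dvd_imp_le[of r "i' - i"] by simp
      qed
      have split: "exceedances T chi {..<n} x \<omega> = (\<Sum>j<r. exceedances T chi (I j) x \<omega>)" for \<omega>
        unfolding exceedances_def I_def
        by (rule sum.group[symmetric]) (use r_pos in auto)
      have "?E {..<n} (real b) \<le> (\<integral>\<omega>. (\<Sum>j<r. max 0 (exceedances T chi (I j) x \<omega> - a)) \<partial>M)"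
      proof (rule integral_mono)
        fix \<omega>
        have "exceedances T chi {..<n} x \<omega> - real b = (\<Sum>j<r. exceedances T chi (I j) x \<omega> - a)"
          using r_pos by (simp add: split sum_subtractf a_def)
        also have "\<dots> \<le> (\<Sum>j<r. max 0 (exceedances T chi (I j) x \<omega> - a))"
          by (intro sum_mono) auto
        finally show "max 0 (exceedances T chi {..<n} x \<omega> - real b)
            \<le> (\<Sum>j<r. max 0 (exceedances T chi (I j) x \<omega> - a))"
          by (simp add: sum_nonneg)
      qed (auto intro!: excess_integrable Bochner_Integration.integrable_sum simp: I_def)
      also have "\<dots> = (\<Sum>j<r. ?E (I j) a)"
        by (intro Bochner_Integration.integral_sum excess_integrable) (simp add: I_def)
      also have "\<dots> \<le> (\<Sum>j<r. 2 * (exp 2 * (r * v)) powr a)"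
      proof (intro sum_mono separated_excess_bound sep)
        fix j
        have "card (I j) \<le> card {..<n}" by (intro card_mono) (auto simp: I_def)
        then have "card (I j) * tail_prob x \<le> n * p"
          unfolding p_def by (intro mult_right_mono) auto
        also have "n * p = a * (r * v)" using b1 r_pos by (simp add: a_def v_def)
        finally show "card (I j) * tail_prob x \<le> a * (r * v)" .
        have "real r * v \<le> r * \<kappa>" using True by (intro mult_left_mono) auto
        also have "\<dots> = exp (- 2)" using r_pos by (simp add: \<kappa>_def exp_minus field_simps)
        also have "\<dots> \<le> 1" by simp
        finally show "r * v \<le> 1" .
      qed (use a True r_pos in \<open>auto simp: I_def\<close>)
      also have "\<dots> = 2 * r * (v / \<kappa>) powr a"
        using r_pos by (simp add: \<kappa>_def mult_ac)
      also have "\<dots> \<le> 2 * r * (v / \<kappa>) powr real k"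
        using True a \<kappa> by (intro mult_left_mono powr_mono') auto
      also have "\<dots> = C * 1 * v ^ k"
        using True \<kappa> by (simp add: powr_realpow C_def power_divide)
      also have "\<dots> \<le> C * b * v ^ k"
        using C b1 v0 by (intro mult_right_mono mult_left_mono) auto
      finally show ?thesis by (simp add: v_def p_def)
    next
      case False
      then have v: "v = 0 \<or> v > \<kappa>" using v0 by linarith
      have "?E {..<n} (real b) \<le> (\<integral>\<omega>. exceedances T chi {..<n} x \<omega> \<partial>M)"
        by (intro integral_mono excess_integrable exceedances_integrable)
          (auto simp: exceedances_bounds)
      also have "\<dots> = b * v" using b1 by (simp add: exceedances_expectation v_def p_def)
      also have "\<dots> \<le> C * b * v ^ k"
      proof (cases "v = 0")
        case True
        then show ?thesis using k C by (simp add: zero_power)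
      next
        case False
        then have vk: "v / \<kappa> \<ge> 1" using v \<kappa> by simp
        obtain l where l: "k = Suc l" using k by (cases k) auto
        have "1 \<le> (v / \<kappa>) ^ l" using vk by (rule one_le_power)
        also have "\<dots> \<le> 2 * r / \<kappa> * (v / \<kappa>) ^ l"
        proof -
          have "1 \<le> 2 * r / \<kappa>" using \<kappa> r_pos by (simp add: field_simps)
          then show ?thesis using mult_right_mono[of 1 "2 * r / \<kappa>" "(v / \<kappa>) ^ l"] vk by simp
        qed
        finally have "b * v * 1 \<le> b * v * (2 * r / \<kappa> * (v / \<kappa>) ^ l)"
          using v0 by (intro mult_left_mono) auto
        also have "\<dots> = C * b * v ^ k" by (simp add: C_def l power_divide)
        finally show ?thesis by simp
      qed
      finally show ?thesis by (simp add: v_def p_def)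
    qed
  qed
qed

end

section \<open>Regularly varying tails\<close>

lemma dyadic_bracket:
  fixes t :: real
  assumes "t \<ge> 1"
  obtains j :: nat where "2 ^ j \<le> t" "t < 2 ^ Suc j"
proof
  define j where "j = nat \<lfloor>log 2 t\<rfloor>"
  have l: "log 2 t \<ge> 0" using assms by simp
  have j: "real j \<le> log 2 t" "log 2 t < real (Suc j)"
    using l by (auto simp: j_def of_nat_nat) linarith+
  have "2 powr real j \<le> 2 powr log 2 t" "2 powr log 2 t < 2 powr real (Suc j)"
    using j by (auto intro!: powr_mono powr_less_mono)
  then show "2 ^ j \<le> t" "t < 2 ^ Suc j"
    using assms powr_realpow[of 2 j] powr_realpow[of 2 "Suc j"] by (simp_all del: power_Suc)
qed

locale regularly_varying_tail =
  fixes p :: "real \<Rightarrow> real" and \<alpha> :: real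
  assumes decreasing: "\<And>x y. 0 < x \<Longrightarrow> x \<le> y \<Longrightarrow> p y \<le> p x"
    and positive: "\<And>x. x > 0 \<Longrightarrow> p x > 0"
    and le_one: "\<And>x. x > 0 \<Longrightarrow> p x \<le> 1"
    and regular: "\<And>t. t > 0 \<Longrightarrow> ((\<lambda>z. p (t * z) / p z) \<longlongrightarrow> t powr (- \<alpha>)) at_top"
begin

text \<open>For a monotone function the bounds of Potter follow by doubling: \<open>p (2 z) / p z\<close> tends to
  \<open>2 powr (- \<alpha>)\<close>, and monotonicity interpolates between dyadic multiples.\<close>

lemma potter_bound_right:
  assumes \<beta>: "0 < \<beta>" "\<beta> < \<alpha>"
  obtains z0 where "z0 > 0" "\<And>z t. z \<ge> z0 \<Longrightarrow> t \<ge> 1 \<Longrightarrow> p (t * z) \<le> 2 powr \<beta> * t powr (- \<beta>) * p z"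
proof -
  have "2 powr (- \<alpha>) < (2::real) powr (- \<beta>)" using \<beta> by simp
  then have "eventually (\<lambda>z. p (2 * z) / p z < 2 powr (- \<beta>)) at_top"
    using regular[of 2] by (intro order_tendstoD(2)) auto
  then obtain z1 where z1: "\<And>z. z \<ge> z1 \<Longrightarrow> p (2 * z) / p z < 2 powr (- \<beta>)"
    by (auto simp: eventually_at_top_linorder)
  define z0 where "z0 = max 1 z1"
  have z0: "z0 > 0" by (simp add: z0_def)
  have iter: "p (2 ^ j * z) \<le> (2 powr (- \<beta>)) ^ j * p z" if z: "z \<ge> z0" for j z
  proof (induction j)
    case (Suc j)
    have ge: "2 ^ j * z \<ge> z" using z z0 by (simp add: mult_le_cancel_right1)
    have "p (2 * (2 ^ j * z)) / p (2 ^ j * z) < 2 powr (- \<beta>)"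
      by (rule z1) (use ge z in \<open>unfold z0_def, linarith\<close>)
    then have "p (2 * (2 ^ j * z)) \<le> 2 powr (- \<beta>) * p (2 ^ j * z)"
      using positive[of "2 ^ j * z"] z z0 by (simp add: pos_divide_less_eq)
    also have "\<dots> \<le> 2 powr (- \<beta>) * ((2 powr (- \<beta>)) ^ j * p z)"
      using Suc by (intro mult_left_mono) auto
    finally show ?case by (simp add: mult_ac)
  qed simp
  show thesis
  proof (rule that[OF z0])
    fix z t :: real assume z: "z \<ge> z0" and t: "t \<ge> 1"
    obtain j where j: "2 ^ j \<le> t" "t < 2 ^ Suc j" using dyadic_bracket[OF t] .
    have "p (t * z) \<le> p (2 ^ j * z)"
      using j z z0 by (intro decreasing mult_right_mono) auto
    also have "\<dots> \<le> (2 powr (- \<beta>)) ^ j * p z" by (rule iter[OF z])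
    also have "(2 powr (- \<beta>)) ^ j = 2 powr \<beta> * (2 ^ Suc j) powr (- \<beta>)"
    proof -
      have "(2::real) ^ Suc j = 2 powr real (Suc j)" by (rule powr_realpow[symmetric]) simp
      then show ?thesis
        by (simp add: powr_powr powr_add[symmetric] algebra_simps powr_realpow[of "2 powr (- \<beta>)", symmetric]
            del: power_Suc)
    qed
    also have "\<dots> \<le> 2 powr \<beta> * t powr (- \<beta>)"
      using j t \<beta> by (intro mult_left_mono powr_mono2') auto
    finally show "p (t * z) \<le> 2 powr \<beta> * t powr (- \<beta>) * p z"
      using positive[of z] z z0 by (simp add: mult_right_mono)
  qed
qed

text \<open>To the left of \<open>z\<close> the doubling argument stops at \<open>z0\<close>. Below it \<open>p \<le> 1\<close>, and the bound already
  proved, applied to the point \<open>z0\<close>, shows that \<open>p z\<close> is not too small.\<close>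

lemma potter_bound_left:
  assumes \<gamma>: "\<alpha> < \<gamma>" "0 < \<gamma>"
  obtains z0 C where "z0 > 0" "C > 0"
    "\<And>z t. z \<ge> z0 \<Longrightarrow> 0 < t \<Longrightarrow> t \<le> 1 \<Longrightarrow> p (t * z) \<le> C * t powr (- \<gamma>) * p z"
proof -
  have "2 powr (- \<gamma>) < (2::real) powr (- \<alpha>)" using \<gamma> by simp
  then have "eventually (\<lambda>z. p (2 * z) / p z > 2 powr (- \<gamma>)) at_top"
    using regular[of 2] by (intro order_tendstoD(1)) auto
  then obtain z1 where z1: "\<And>z. z \<ge> z1 \<Longrightarrow> p (2 * z) / p z > 2 powr (- \<gamma>)"
    by (auto simp: eventually_at_top_linorder)
  define z0 where "z0 = max 1 z1"
  have z0: "z0 > 0" by (simp add: z0_def)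
  have iter: "p w \<le> (2 powr \<gamma>) ^ j * p (2 ^ j * w)" if w: "w \<ge> z0" for j w
  proof (induction j)
    case (Suc j)
    have ge: "2 ^ j * w \<ge> w" using w z0 by (simp add: mult_le_cancel_right1)
    have "p (2 * (2 ^ j * w)) / p (2 ^ j * w) > 2 powr (- \<gamma>)"
      by (rule z1) (use ge w in \<open>unfold z0_def, linarith\<close>)
    then have "p (2 ^ j * w) \<le> 2 powr \<gamma> * p (2 * (2 ^ j * w))"
      using positive[of "2 ^ j * w"] w z0 by (simp add: pos_less_divide_eq powr_minus field_simps)
    then have step: "(2 powr \<gamma>) ^ j * p (2 ^ j * w) \<le> (2 powr \<gamma>) ^ j * (2 powr \<gamma> * p (2 * (2 ^ j * w)))"
      by (rule mult_left_mono) auto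
    have "p w \<le> (2 powr \<gamma>) ^ j * (2 powr \<gamma> * p (2 * (2 ^ j * w)))"
      using Suc step by (rule order_trans)
    then show ?case by (simp add: mult_ac)
  qed simp
  have main: "p (t * z) \<le> 2 powr \<gamma> * t powr (- \<gamma>) * p z"
    if w: "t * z \<ge> z0" and t: "0 < t" "t \<le> 1" for t z
  proof -
    have z: "z > 0" using w z0 t by (metis less_le_trans zero_less_mult_pos)
    have "1 / t \<ge> 1" using t by simp
    then obtain j where j: "2 ^ j \<le> 1 / t" "1 / t < 2 ^ Suc j" by (rule dyadic_bracket)
    have "p (t * z) \<le> (2 powr \<gamma>) ^ Suc j * p (2 ^ Suc j * (t * z))" by (rule iter[OF w])
    also have "\<dots> \<le> (2 powr \<gamma>) ^ Suc j * p z"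
    proof (intro mult_left_mono decreasing z)
      have "1 \<le> 2 ^ Suc j * t" using j t by (simp add: field_simps)
      from mult_right_mono[OF this, of z] show "z \<le> 2 ^ Suc j * (t * z)" using z by (simp add: mult_ac)
    qed auto
    also have "(2 powr \<gamma>) ^ Suc j = 2 powr \<gamma> * (2 ^ j) powr \<gamma>"
      by (simp add: powr_powr powr_add[symmetric] algebra_simps flip: powr_realpow)
    also have "\<dots> * p z \<le> 2 powr \<gamma> * (1 / t) powr \<gamma> * p z"
      using j \<gamma> positive[OF z] by (intro mult_right_mono mult_left_mono powr_mono2) auto
    also have "(1 / t) powr \<gamma> = t powr (- \<gamma>)"
      using t by (simp add: powr_minus powr_divide inverse_eq_divide)
    finally show ?thesis .
  qed
  define C where "C = 2 powr \<gamma> / p z0"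
  have pz0: "0 < p z0" "p z0 \<le> 1" using positive le_one z0 by auto
  have C: "C > 0" "2 powr \<gamma> \<le> C" using pz0 by (auto simp: C_def field_simps)
  show thesis
  proof (rule that[OF z0 C(1)])
    fix z t :: real assume z: "z \<ge> z0" and t: "0 < t" "t \<le> 1"
    have pz: "p z > 0" using z z0 positive by auto
    show "p (t * z) \<le> C * t powr (- \<gamma>) * p z"
    proof (cases "t * z \<ge> z0")
      case True
      have "2 powr \<gamma> * t powr (- \<gamma>) * p z \<le> C * t powr (- \<gamma>) * p z"
        using C pz by (intro mult_right_mono) auto
      then show ?thesis using main[OF True t] by linarith
    next
      case False
      have "t \<le> z0 / z" using False z z0 by (simp add: field_simps)
      have "p z0 \<le> 2 powr \<gamma> * (z0 / z) powr (- \<gamma>) * p z"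
        using main[of "z0 / z" z] z z0 by simp
      also have "\<dots> \<le> 2 powr \<gamma> * t powr (- \<gamma>) * p z"
        using pz t \<gamma> \<open>t \<le> z0 / z\<close> by (intro mult_right_mono mult_left_mono powr_mono2') auto
      finally have "1 \<le> C * t powr (- \<gamma>) * p z" using pz0 by (simp add: C_def field_simps)
      moreover have "p (t * z) \<le> 1" using t z z0 by (intro le_one) auto
      ultimately show ?thesis by linarith
    qed
  qed
qed

end

text \<open>The tail is positive everywhere because it decreases and \<open>L\<close>, having ratios \<open>L (2 x) / L x\<close> close
  to one, cannot vanish far out.\<close>

lemma tail_of_slowly_varying:
  assumes L: "slowly_varying L" and tail: "\<And>x. x > 0 \<Longrightarrow> p x = L x / x powr \<alpha>"
    and nonneg: "\<And>x. p x \<ge> 0" and le_one: "\<And>x. p x \<le> 1"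
    and decreasing: "\<And>x y. x \<le> y \<Longrightarrow> p y \<le> p x"
  shows "regularly_varying_tail p \<alpha>"
proof
  fix x :: real assume x: "x > 0"
  have "((\<lambda>x. L (2 * x) / L x) \<longlongrightarrow> 1) at_top" using L by (simp add: slowly_varying_def)
  then have "eventually (\<lambda>x. L (2 * x) / L x > 0) at_top" by (rule order_tendstoD(1)) auto
  then have "eventually (\<lambda>y. L (2 * y) / L y > 0 \<and> y \<ge> x) at_top"
    by (intro eventually_conj eventually_ge_at_top)
  then obtain y where "L (2 * y) / L y > 0" "y \<ge> x"
    by (metis (mono_tags, lifting) eventually_at_top_linorder order_refl)
  then have "p y \<noteq> 0" using tail[of y] x by auto
  then show "p x > 0" using nonneg[of y] decreasing[OF \<open>y \<ge> x\<close>] by linarith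
next
  fix t :: real assume t: "t > 0"
  have "((\<lambda>x. t powr (- \<alpha>) * (L (t * x) / L x)) \<longlongrightarrow> t powr (- \<alpha>) * 1) at_top"
    using L t by (intro tendsto_mult tendsto_const) (auto simp: slowly_varying_def)
  then have "((\<lambda>x. t powr (- \<alpha>) * (L (t * x) / L x)) \<longlongrightarrow> t powr (- \<alpha>)) at_top" by simp
  moreover have "eventually (\<lambda>z. t powr (- \<alpha>) * (L (t * z) / L z) = p (t * z) / p z) at_top"
    using eventually_gt_at_top[of 0]
    by eventually_elim (use t in \<open>simp add: tail powr_mult powr_minus field_simps\<close>)
  ultimately show "((\<lambda>z. p (t * z) / p z) \<longlongrightarrow> t powr (- \<alpha>)) at_top"
    by (rule Lim_transform_eventually)
qed (blast intro: decreasing le_one)+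

text \<open>The de Bruijn conjugate inverts the tail: with \<open>z = y * Lsharp y\<close>, the product
  \<open>y powr \<alpha> * p z = L z / Lsharp y powr \<alpha>\<close> is the power \<open>- \<alpha>\<close> of the quantity that tends to one by definition.\<close>

lemma de_Bruijn_inverts_tail:
  assumes Lsharp: "de_Bruijn_conjugate (\<lambda>x. L x powr (- 1 / \<alpha>)) Lsharp" and \<alpha>: "\<alpha> > 0"
    and tail: "\<And>x. x > 0 \<Longrightarrow> p x = L x / x powr \<alpha>" and nonneg: "\<And>x. p x \<ge> 0"
  shows "eventually (\<lambda>y. y * Lsharp y > 0) at_top"
    and "((\<lambda>y. y powr \<alpha> * p (y * Lsharp y)) \<longlongrightarrow> 1) at_top"
proof -
  define h where "h = (\<lambda>y. Lsharp y * L (y * Lsharp y) powr (- 1 / \<alpha>))"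
  have h: "(h \<longlongrightarrow> 1) at_top" using Lsharp by (simp add: de_Bruijn_conjugate_def h_def)
  have ev: "eventually (\<lambda>y. h y > 0 \<and> y > 0) at_top"
    using order_tendstoD(1)[OF h, of 0] by (auto intro: eventually_conj eventually_gt_at_top)
  have pos: "Lsharp y > 0" "L (y * Lsharp y) \<noteq> 0" if "h y > 0" for y
    using that by (auto simp: h_def zero_less_mult_iff)
  show "eventually (\<lambda>y. y * Lsharp y > 0) at_top"
    using ev by eventually_elim (use pos in auto)
  have "((\<lambda>y. h y powr (- \<alpha>)) \<longlongrightarrow> 1 powr (- \<alpha>)) at_top"
    by (intro tendsto_powr h tendsto_const) auto
  then have "((\<lambda>y. h y powr (- \<alpha>)) \<longlongrightarrow> 1) at_top" by simp
  moreover have "eventually (\<lambda>y. h y powr (- \<alpha>) = y powr \<alpha> * p (y * Lsharp y)) at_top"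
    using ev
  proof eventually_elim
    case (elim y)
    define z where "z = y * Lsharp y"
    have z: "z > 0" using pos elim by (simp add: z_def)
    have "L z = p z * z powr \<alpha>" using tail[OF z] z by simp
    then have Lz: "L z > 0" using pos(2)[of y] elim nonneg[of z] z
      by (metis less_eq_real_def mult_nonneg_nonneg powr_ge_zero z_def)
    have "h y powr (- \<alpha>) = Lsharp y powr (- \<alpha>) * L z"
      using pos[of y] elim Lz \<alpha> by (simp add: h_def z_def[symmetric] powr_mult powr_powr)
    also have "\<dots> = y powr \<alpha> * p z"
      using pos[of y] elim tail[OF z] by (simp add: z_def powr_mult powr_minus field_simps)
    finally show ?case by (simp add: z_def)
  qed
  ultimately show "((\<lambda>y. y powr \<alpha> * p (y * Lsharp y)) \<longlongrightarrow> 1) at_top"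
    by (rule Lim_transform_eventually)
qed

section \<open>Trimmed sums as integrals of excesses\<close>

text \<open>In a decreasing list the entries above \<open>x\<close> form an initial segment, so removing the \<open>b\<close> largest
  entries removes \<open>b\<close> of those, or all of them.\<close>

lemma length_filter_drop_decreasing:
  fixes ys :: "real list"
  assumes "sorted_wrt (\<lambda>a c. a \<ge> c) ys"
  shows "length (filter (\<lambda>y. y > x) (drop b ys)) = length (filter (\<lambda>y. y > x) ys) - b"
  using assms
proof (induction ys arbitrary: b)
  case (Cons y ys)
  show ?case
  proof (cases b)
    case (Suc b')
    show ?thesis
    proof (cases "y > x")
      case False
      then have "filter (\<lambda>y. y > x) ys = []" using Cons.prems by (auto simp: filter_empty_conv)
      then show ?thesis using Cons False Suc by simp
    qed (use Cons Suc in simp)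
  qed simp
qed simp

lemma sum_list_eq_layer_integral:
  assumes "\<forall>z\<in>set zs. z \<ge> 0"
  shows "(\<integral>\<^sup>+x. ennreal (indicator {0<..} x * real (length (filter (\<lambda>y. y > x) zs))) \<partial>lborel) = ennreal (sum_list zs)"
  using assms
proof (induction zs)
  case (Cons z zs)
  have meas: "(\<lambda>x. indicator {0<..} x * real (length (filter (\<lambda>y. y > x) zs))) \<in> borel_measurable lborel"
  proof (induction zs)
    case (Cons a zs)
    have "(\<lambda>x. indicator {0<..} x * real (length (filter (\<lambda>y. y > x) (a # zs))))
        = (\<lambda>x. indicator {0<..<a} x + indicator {0<..} x * real (length (filter (\<lambda>y. y > x) zs)))"
      by (auto simp: fun_eq_iff indicator_def)
    then show ?case using Cons by simp
  qed simp
  have "(\<integral>\<^sup>+x. ennreal (indicator {0<..} x * real (length (filter (\<lambda>y. y > x) (z # zs)))) \<partial>lborel)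
      = (\<integral>\<^sup>+x. indicator {0<..<z} x + ennreal (indicator {0<..} x * real (length (filter (\<lambda>y. y > x) zs))) \<partial>lborel)"
    by (intro nn_integral_cong) (auto simp: indicator_def simp flip: ennreal_plus ennreal_1)
  also have "\<dots> = ennreal z + ennreal (sum_list zs)"
    using Cons meas by (subst nn_integral_add) auto
  also have "\<dots> = ennreal (sum_list (z # zs))"
    using Cons.prems by (simp add: sum_list_nonneg)
  finally show ?case .
qed simp

lemma exceedances_eq_length:
  "exceedances T chi {..<n} x \<omega> = real (length (filter (\<lambda>y. y > x) (map (\<lambda>k. chi ((T ^^ k) \<omega>)) [0..<n])))"
  by (induction n) (auto simp: exceedances_def)

lemma trimmed_sum_eq_layer_integral:
  assumes "\<And>k. k < n \<Longrightarrow> chi ((T ^^ k) \<omega>) \<ge> 0"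
  shows "ennreal (trimmed_sum T chi n b \<omega>) =
    (\<integral>\<^sup>+x. ennreal (indicator {0<..} x * max 0 (exceedances T chi {..<n} x \<omega> - real b)) \<partial>lborel)"
proof -
  define xs where "xs = map (\<lambda>k. chi ((T ^^ k) \<omega>)) [0..<n]"
  define ys where "ys = rev (sort xs)"
  have dec: "sorted_wrt (\<lambda>a c. a \<ge> c) ys" by (simp add: ys_def sorted_wrt_rev)
  have len: "length (filter (\<lambda>y. y > x) ys) = length (filter (\<lambda>y. y > x) xs)" for x
    by (simp add: ys_def filter_sort flip: rev_filter)
  have "real (length (filter (\<lambda>y. y > x) (drop b ys))) = max 0 (exceedances T chi {..<n} x \<omega> - real b)" for x
    unfolding length_filter_drop_decreasing[OF dec] len exceedances_eq_length xs_def[symmetric]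
    by (simp add: of_nat_diff_if max_def)
  moreover have "\<forall>z\<in>set (drop b ys). z \<ge> 0"
    using assms set_drop_subset[of b ys] by (auto simp: ys_def xs_def)
  ultimately show ?thesis
    using sum_list_eq_layer_integral[of "drop b ys"] by (simp add: trimmed_sum_def xs_def ys_def)
qed

lemma (in psi_mixing_observable) exceedances_measurable_pair:
  "(\<lambda>(\<omega>, x). exceedances T chi I x \<omega>) \<in> borel_measurable (M \<Otimes>\<^sub>M lborel)"
proof -
  have [measurable]: "(\<lambda>z. chi ((T ^^ i) (fst z))) \<in> borel_measurable (M \<Otimes>\<^sub>M lborel)" for i
    by (rule measurable_compose[OF measurable_fst iterate_measurable])
  show ?thesis unfolding exceedances_def case_prod_beta by measurable
qed

lemma (in psi_mixing_observable) expected_excess_measurable: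
  "(\<lambda>x. \<integral>\<omega>. max 0 (exceedances T chi I x \<omega> - a) \<partial>M) \<in> borel_measurable lborel"
proof -
  have [measurable]: "(\<lambda>(\<omega>, x). exceedances T chi I x \<omega>) \<in> borel_measurable (M \<Otimes>\<^sub>M lborel)"
    by (rule exceedances_measurable_pair)
  have "(\<lambda>(x, \<omega>). max 0 (exceedances T chi I x \<omega> - a)) \<in> borel_measurable (lborel \<Otimes>\<^sub>M M)"
    by (subst measurable_pair_swap_iff) measurable
  then show ?thesis by measurable
qed

lemma (in psi_mixing_observable) expectation_trimmed_sum:
  assumes nonneg: "\<And>\<omega>. \<omega> \<in> space M \<Longrightarrow> chi \<omega> \<ge> 0"
  shows "(\<integral>\<omega>. trimmed_sum T chi n b \<omega> \<partial>M) =
    (\<integral>x. indicator {0<..} x * (\<integral>\<omega>. max 0 (exceedances T chi {..<n} x \<omega> - real b) \<partial>M) \<partial>lborel)"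
proof -
  interpret pair_sigma_finite M lborel by unfold_locales
  define g where "g = (\<lambda>\<omega> x. indicator {0<..} x * max 0 (exceedances T chi {..<n} x \<omega> - real b))"
  define e where "e = (\<lambda>x. \<integral>\<omega>. max 0 (exceedances T chi {..<n} x \<omega> - real b) \<partial>M)"
  have [measurable]: "(\<lambda>(\<omega>, x). exceedances T chi {..<n} x \<omega>) \<in> borel_measurable (M \<Otimes>\<^sub>M lborel)"
    by (rule exceedances_measurable_pair)
  have g_meas [measurable]: "(\<lambda>(\<omega>, x). g \<omega> x) \<in> borel_measurable (M \<Otimes>\<^sub>M lborel)"
    unfolding g_def by measurable
  have e_meas: "e \<in> borel_measurable lborel" unfolding e_def by (rule expected_excess_measurable)
  have Tm: "T \<in> measurable M M" using invariant by (simp add: invariant_measure_def)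
  have layer: "ennreal (trimmed_sum T chi n b \<omega>) = (\<integral>\<^sup>+x. ennreal (g \<omega> x) \<partial>lborel)" if "\<omega> \<in> space M" for \<omega>
    unfolding g_def
    by (rule trimmed_sum_eq_layer_integral)
      (use nonneg measurable_space[OF measurable_iterate[OF Tm] that] in blast)
  have trimmed_nonneg: "trimmed_sum T chi n b \<omega> \<ge> 0" if "\<omega> \<in> space M" for \<omega>
  proof -
    have "\<forall>k. chi ((T ^^ k) \<omega>) \<ge> 0" using nonneg measurable_space[OF measurable_iterate[OF Tm] that] by blast
    then show ?thesis unfolding trimmed_sum_def
      by (intro sum_list_nonneg) (auto dest!: set_drop_subset[THEN subsetD])
  qed
  have trimmed_meas: "trimmed_sum T chi n b \<in> borel_measurable M"
  proof -
    have "(\<lambda>\<omega>. enn2real (\<integral>\<^sup>+x. ennreal (g \<omega> x) \<partial>lborel)) \<in> borel_measurable M" by measurable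
    moreover have "trimmed_sum T chi n b \<omega> = enn2real (\<integral>\<^sup>+x. ennreal (g \<omega> x) \<partial>lborel)" if "\<omega> \<in> space M" for \<omega>
      using trimmed_nonneg[OF that] by (simp flip: layer[OF that])
    ultimately show ?thesis by (simp cong: measurable_cong)
  qed
  have "(\<integral>\<omega>. trimmed_sum T chi n b \<omega> \<partial>M) = enn2real (\<integral>\<^sup>+\<omega>. ennreal (trimmed_sum T chi n b \<omega>) \<partial>M)"
    by (rule integral_eq_nn_integral[OF trimmed_meas]) (use trimmed_nonneg in auto)
  also have "(\<integral>\<^sup>+\<omega>. ennreal (trimmed_sum T chi n b \<omega>) \<partial>M) = (\<integral>\<^sup>+\<omega>. (\<integral>\<^sup>+x. ennreal (g \<omega> x) \<partial>lborel) \<partial>M)"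
    by (intro nn_integral_cong layer)
  also have "\<dots> = (\<integral>\<^sup>+x. (\<integral>\<^sup>+\<omega>. ennreal (g \<omega> x) \<partial>M) \<partial>lborel)"
    by (rule Fubini'[symmetric]) measurable
  also have "\<dots> = (\<integral>\<^sup>+x. ennreal (indicator {0<..} x * e x) \<partial>lborel)"
  proof (rule nn_integral_cong)
    fix x
    have "(\<integral>\<^sup>+\<omega>. ennreal (g \<omega> x) \<partial>M) = ennreal (\<integral>\<omega>. g \<omega> x \<partial>M)"
      unfolding g_def
      by (intro nn_integral_eq_integral integrable_mult_right excess_integrable) auto
    then show "(\<integral>\<^sup>+\<omega>. ennreal (g \<omega> x) \<partial>M) = ennreal (indicator {0<..} x * e x)"
      by (simp add: g_def e_def)
  qed
  also have "enn2real \<dots> = (\<integral>x. indicator {0<..} x * e x \<partial>lborel)"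
    using e_meas by (intro integral_eq_nn_integral[symmetric]) (auto simp: e_def)
  finally show ?thesis unfolding e_def .
qed

section \<open>Power integrals\<close>

lemma power_integral_unit_interval:
  assumes "(a::real) > -1"
  shows "has_bochner_integral lborel (\<lambda>t. indicator {0..1} t * t powr a) (1 / (a + 1))"
proof (rule has_bochner_integral_nn_integral)
  show "(\<integral>\<^sup>+t. ennreal (indicator {0..1} t * t powr a) \<partial>lborel) = ennreal (1 / (a + 1))"
    using has_integral_powr_from_0[OF assms, of 1]
    by (intro nn_integral_has_integral_lebesgue) auto
qed (use assms in auto)

lemma power_integrable_at_infinity:
  "integrable lborel (\<lambda>t::real. indicator {1..} t * t powr (- 2))"
proof (rule integrableI_nonneg)
  have "(\<integral>\<^sup>+t. ennreal (indicator {1..} t * t powr (- 2)) \<partial>lborel) = ennreal 1"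
    using has_integral_powr_to_inf[of "-2" 1]
    by (intro nn_integral_has_integral_lebesgue) auto
  then show "(\<integral>\<^sup>+t. ennreal (indicator {1..} t * t powr (- 2)) \<partial>lborel) < \<infinity>" by simp
qed auto

lemma limit_excess_integral:
  fixes \<alpha> :: real
  assumes \<alpha>: "0 < \<alpha>" "\<alpha> < 1"
  shows "(\<integral>t. indicator {0<..} t * max 0 (t powr (- \<alpha>) - 1) \<partial>lborel) = \<alpha> / (1 - \<alpha>)"
proof -
  have eq: "indicator {0<..} t * max 0 (t powr (- \<alpha>) - 1) = indicator {0..1} t * t powr (- \<alpha>) - indicator {0<..1} t"
    for t :: real
  proof -
    have "t powr (- \<alpha>) \<ge> 1" if "0 < t" "t \<le> 1"
      using that \<alpha> powr_mono2'[of "- \<alpha>" t 1] by simp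
    moreover have "t powr (- \<alpha>) \<le> 1" if "t > 1"
      using that \<alpha> powr_mono2'[of "- \<alpha>" 1 t] by simp
    ultimately show ?thesis by (cases "t \<le> 0"; cases "t \<le> 1") (auto simp: indicator_def)
  qed
  have "has_bochner_integral lborel (\<lambda>t::real. indicator {0..1} t * t powr (- \<alpha>)) (1 / (- \<alpha> + 1))"
    by (rule power_integral_unit_interval) (use \<alpha> in simp)
  then have "has_bochner_integral lborel (\<lambda>t::real. indicator {0..1} t * t powr (- \<alpha>) - indicator {0<..1} t)
      (1 / (- \<alpha> + 1) - 1)"
    by (intro has_bochner_integral_diff) (auto simp: has_bochner_integral_iff)
  then show ?thesis unfolding eq using \<alpha> by (simp add: has_bochner_integral_iff field_simps)
qed

section \<open>The expected excess at a fixed level\<close>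

lemma (in prob_space) L1_le_L2:
  fixes f :: "'a \<Rightarrow> real"
  assumes f: "integrable M f" and f2: "integrable M (\<lambda>x. (f x)\<^sup>2)"
  shows "(\<integral>x. \<bar>f x\<bar> \<partial>M) \<le> sqrt (\<integral>x. (f x)\<^sup>2 \<partial>M)"
proof (rule real_le_rsqrt)
  define m where "m = (\<integral>x. \<bar>f x\<bar> \<partial>M)"
  have "0 \<le> (\<integral>x. (\<bar>f x\<bar> - m)\<^sup>2 \<partial>M)" by simp
  also have "\<dots> = (\<integral>x. (f x)\<^sup>2 - (2 * m * \<bar>f x\<bar> - m\<^sup>2) \<partial>M)"
    by (intro Bochner_Integration.integral_cong refl) (simp add: power2_eq_square algebra_simps)
  also have "\<dots> = (\<integral>x. (f x)\<^sup>2 \<partial>M) - m\<^sup>2"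
    using f f2 by (simp add: prob_space power2_eq_square flip: m_def)
  finally show "(\<integral>x. \<bar>f x\<bar> \<partial>M)\<^sup>2 \<le> (\<integral>x. (f x)\<^sup>2 \<partial>M)" by (simp add: m_def)
qed

text \<open>As the positive part is Lipschitz, the expected excess differs from the excess of the expectation by
  at most the standard deviation, which is of order \<open>sqrt (n p)\<close> and hence \<open>o(b)\<close> when \<open>n p\<close> is
  of order \<open>b\<close>.\<close>

lemma (in psi_mixing_observable) expected_excess_tendsto:
  fixes b :: "nat \<Rightarrow> nat" and x :: "nat \<Rightarrow> real"
  assumes var: "\<And>n. (\<integral>\<omega>. (exceedances T chi {..<n} (x n) \<omega> - real n * tail_prob (x n))\<^sup>2 \<partial>M)
      \<le> K * (real n * tail_prob (x n))"
    and b: "filterlim b at_top sequentially"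
    and v: "(\<lambda>n. real n * tail_prob (x n) / b n) \<longlonglongrightarrow> c"
  shows "(\<lambda>n. (\<integral>\<omega>. max 0 (exceedances T chi {..<n} (x n) \<omega> - real (b n)) \<partial>M) / b n) \<longlonglongrightarrow> max 0 (c - 1)"
proof -
  define m where "m = (\<lambda>n. real n * tail_prob (x n))"
  define e where "e = (\<lambda>n. (\<integral>\<omega>. max 0 (exceedances T chi {..<n} (x n) \<omega> - real (b n)) \<partial>M))"
  have dev: "\<bar>e n - max 0 (m n - b n)\<bar> \<le> sqrt (K * m n)" for n
  proof -
    let ?N = "exceedances T chi {..<n} (x n)"
    have int: "integrable M (\<lambda>\<omega>. ?N \<omega> - m n)"
      by (intro Bochner_Integration.integrable_diff exceedances_integrable) auto
    have int2: "integrable M (\<lambda>\<omega>. (?N \<omega> - m n)\<^sup>2)"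
    proof (rule integrable_const_bound)
      show "AE \<omega> in M. norm ((?N \<omega> - m n)\<^sup>2) \<le> (real n + \<bar>m n\<bar>)\<^sup>2"
      proof (intro AE_I2)
        fix \<omega>
        have "\<bar>?N \<omega> - m n\<bar> \<le> real n + \<bar>m n\<bar>"
          using exceedances_bounds[where I = "{..<n}" and x = "x n" and \<omega> = \<omega>] by auto
        then have "\<bar>?N \<omega> - m n\<bar>\<^sup>2 \<le> (real n + \<bar>m n\<bar>)\<^sup>2" by (intro power_mono) auto
        then show "norm ((?N \<omega> - m n)\<^sup>2) \<le> (real n + \<bar>m n\<bar>)\<^sup>2" by simp
      qed
    qed measurable
    have ex: "integrable M (\<lambda>\<omega>. max 0 (?N \<omega> - real (b n)))" by (rule excess_integrable) simp
    have "e n - max 0 (m n - b n) = (\<integral>\<omega>. max 0 (?N \<omega> - real (b n)) - max 0 (m n - b n) \<partial>M)"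
      using ex by (simp add: e_def prob_space)
    also have "\<bar>\<dots>\<bar> \<le> (\<integral>\<omega>. \<bar>max 0 (?N \<omega> - real (b n)) - max 0 (m n - b n)\<bar> \<partial>M)"
      by (rule integral_abs_bound)
    also have "\<dots> \<le> (\<integral>\<omega>. \<bar>?N \<omega> - m n\<bar> \<partial>M)"
      using ex int by (intro integral_mono) auto
    also have "\<dots> \<le> sqrt (\<integral>\<omega>. (?N \<omega> - m n)\<^sup>2 \<partial>M)" by (rule L1_le_L2[OF int int2])
    also have "\<dots> \<le> sqrt (K * m n)" unfolding m_def by (intro real_sqrt_le_mono var)
    finally show ?thesis .
  qed
  have b_real: "filterlim (\<lambda>n. real (b n)) at_top sequentially"
    by (rule filterlim_compose[OF filterlim_real_sequentially b])
  have ev: "eventually (\<lambda>n. real (b n) > 0) sequentially"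
    using b_real unfolding filterlim_at_top_dense by blast
  have "(\<lambda>n. sqrt (K * (m n / b n) * (1 / b n))) \<longlonglongrightarrow> sqrt (K * c * 0)"
    using v tendsto_inverse_0_at_top[OF b_real]
    by (intro tendsto_real_sqrt tendsto_mult tendsto_const) (auto simp: m_def inverse_eq_divide)
  then have small: "(\<lambda>n. sqrt (K * (m n / b n) * (1 / b n))) \<longlonglongrightarrow> 0" by simp
  have "(\<lambda>n. e n / b n - max 0 (m n / b n - 1)) \<longlonglongrightarrow> 0"
  proof (rule Lim_null_comparison[OF _ small])
    show "eventually (\<lambda>n. norm (e n / b n - max 0 (m n / b n - 1)) \<le> sqrt (K * (m n / b n) * (1 / b n))) sequentially"
      using ev
    proof eventually_elim
      case (elim n)
      have "max 0 (m n / b n - 1) = max 0 (m n - b n) / b n"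
        using elim by (simp add: max_def field_simps)
      then have "norm (e n / b n - max 0 (m n / b n - 1)) = \<bar>e n - max 0 (m n - b n)\<bar> / b n"
        using elim by (simp flip: diff_divide_distrib)
      also have "\<dots> \<le> sqrt (K * m n) / b n" using dev elim by (intro divide_right_mono) auto
      also have "\<dots> = sqrt (K * m n / (real (b n))\<^sup>2)" using elim by (simp add: real_sqrt_divide)
      also have "\<dots> = sqrt (K * (m n / b n) * (1 / b n))" by (simp add: power2_eq_square)
      finally show ?case .
    qed
  qed
  moreover have "(\<lambda>n. max 0 (m n / b n - 1)) \<longlonglongrightarrow> max 0 (c - 1)"
    using v by (intro tendsto_max tendsto_diff tendsto_const) (auto simp: m_def)
  ultimately have "(\<lambda>n. (e n / b n - max 0 (m n / b n - 1)) + max 0 (m n / b n - 1)) \<longlonglongrightarrow> 0 + max 0 (c - 1)"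
    by (rule tendsto_add)
  then show ?thesis by (simp add: e_def)
qed

section \<open>Asymptotics of the expected trimmed sum\<close>

theorem lemma2p1:
  fixes M :: "'a measure" and T :: "'a \<Rightarrow> 'a"
    and F :: "('a \<Rightarrow> complex) set" and nrm :: "('a \<Rightarrow> complex) \<Rightarrow> real"
    and chi :: "'a \<Rightarrow> real" and L Lsharp :: "real \<Rightarrow> real" and \<alpha> :: real
    and b :: "nat \<Rightarrow> nat" and d :: "nat \<Rightarrow> real"
  assumes D: "property_D M T F nrm chi"
    and alpha: "0 < \<alpha>" "\<alpha> < 1"
    and L: "slowly_varying L"
    and tail: "\<And>x. x > 0 \<Longrightarrow> measure M {\<omega> \<in> space M. chi \<omega> > x} = L x / x powr \<alpha>"
    and b_pos: "\<And>n. n \<ge> 1 \<Longrightarrow> b n \<ge> 1"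
    and b_infinity: "filterlim b at_top sequentially"
    and b_small: "(\<lambda>n. real (b n)) \<in> o(\<lambda>n. real n)"
    and psi: "\<exists>r\<ge>1. psi_coefficient M (\<lambda>n x. chi ((T ^^ (n - 1)) x)) r < 1"
    and Lsharp: "de_Bruijn_conjugate (\<lambda>x. L x powr (- 1 / \<alpha>)) Lsharp"
    and d_eq: "\<And>n. n \<ge> 1 \<Longrightarrow> d n = \<alpha> / (1 - \<alpha>) * real n powr (1 / \<alpha>) * real (b n) powr (1 - 1 / \<alpha>)
                 * Lsharp ((real n / real (b n)) powr (1 / \<alpha>))"
  shows "(\<lambda>n. (\<integral>x. trimmed_sum T chi n (b n) x \<partial>M) / d n) \<longlonglongrightarrow> 1"
proof -
  obtain r where r: "r \<ge> 1" "psi_coefficient M (\<lambda>n x. chi ((T ^^ (n - 1)) x)) r < 1"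
    using psi by blast
  have chi [measurable]: "chi \<in> borel_measurable M" and chi_nonneg: "\<And>\<omega>. \<omega> \<in> space M \<Longrightarrow> chi \<omega> \<ge> 0"
    using D by (auto simp: property_D_def)
  have C: "property_C M T F nrm" using D by (simp add: property_D_def)
  interpret prob_space M using C by (simp add: property_C_def)
  interpret psi_mixing_observable M T chi r
    by unfold_locales (use C chi r in \<open>auto simp: property_C_def\<close>)
  define p where "p = (\<lambda>x. measure M {\<omega> \<in> space M. chi \<omega> > x})"
  have p_eq: "measure M {\<omega> \<in> space M. chi \<omega> > x} = p x" for x by (simp add: p_def)
  have p_tail: "p x = L x / x powr \<alpha>" if "x > 0" for x using tail[OF that] by (simp add: p_def)
  have p_nonneg: "p x \<ge> 0" for x by (simp add: p_def)
  have p_decreasing: "p y \<le> p x" if "x \<le> y" for x y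
    unfolding p_def by (rule finite_measure_mono) (use that in auto)
  have p_le_1: "p x \<le> 1" for x unfolding p_def by (rule prob_le_1)
  interpret rv: regularly_varying_tail p \<alpha>
    by (rule tail_of_slowly_varying[OF L p_tail p_nonneg p_le_1 p_decreasing])

  \<comment> \<open>The level \<open>xs n\<close> is the one with about \<open>b n\<close> expected exceedances, and \<open>d n\<close> is
    \<open>\<alpha> / (1 - \<alpha>) * b n * xs n\<close>.\<close>
  define y where "y = (\<lambda>n. (real n / real (b n)) powr (1 / \<alpha>))"
  define xs where "xs = (\<lambda>n. y n * Lsharp (y n))"
  have n_pos: "eventually (\<lambda>n. n \<ge> 1) sequentially" by (rule eventually_ge_at_top)
  have ratio_0: "(\<lambda>n. real (b n) / real n) \<longlonglongrightarrow> 0" using b_small by (rule smalloD_tendsto)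
  have "filterlim (\<lambda>n. inverse (real (b n) / real n)) at_top sequentially"
    by (rule filterlim_inverse_at_top[OF ratio_0])
      (use n_pos in \<open>eventually_elim, use b_pos in force\<close>)
  then have ratio_inf: "filterlim (\<lambda>n. real n / real (b n)) at_top sequentially" by simp
  have y_inf: "filterlim y at_top sequentially"
    unfolding y_def by (rule filterlim_compose[OF real_powr_at_top ratio_inf]) (use alpha in simp)
  have y_powr: "eventually (\<lambda>n. y n powr \<alpha> = real n / real (b n)) sequentially"
    using n_pos by eventually_elim (use alpha in \<open>simp add: y_def powr_powr\<close>)
  have xs_pos: "eventually (\<lambda>n. xs n > 0) sequentially"
    unfolding xs_def using eventually_compose_filterlim[OF de_Bruijn_inverts_tail(1)[OF Lsharp alpha(1) p_tail p_nonneg] y_inf] .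
  have "(\<lambda>n. y n powr \<alpha> * p (xs n)) \<longlonglongrightarrow> 1"
    unfolding xs_def
    by (rule filterlim_compose[OF de_Bruijn_inverts_tail(2)[OF Lsharp alpha(1) p_tail p_nonneg] y_inf])
  moreover have "eventually (\<lambda>n. y n powr \<alpha> * p (xs n) = real n * p (xs n) / b n) sequentially"
    using y_powr by eventually_elim simp
  ultimately have count_1: "(\<lambda>n. real n * p (xs n) / b n) \<longlonglongrightarrow> 1"
    by (rule Lim_transform_eventually)
  have "(\<lambda>n. (real n * p (xs n) / b n) * (b n / n)) \<longlonglongrightarrow> 1 * 0"
    by (intro tendsto_mult count_1 ratio_0)
  moreover have "eventually (\<lambda>n. (real n * p (xs n) / b n) * (b n / n) = p (xs n)) sequentially"
    using n_pos by eventually_elim (use b_pos in force)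
  ultimately have p_0: "(\<lambda>n. p (xs n)) \<longlonglongrightarrow> 0"
    using Lim_transform_eventually by fastforce
  have xs_inf: "filterlim xs at_top sequentially"
  proof (subst filterlim_at_top_gt[of _ _ 0], intro allI impI)
    fix z :: real assume z: "z > 0"
    have "eventually (\<lambda>n. p (xs n) < p z) sequentially"
      using order_tendstoD(2)[OF p_0 rv.positive[OF z]] .
    then show "eventually (\<lambda>n. z \<le> xs n) sequentially"
      by eventually_elim (use p_decreasing in \<open>metis less_le_not_le linear\<close>)
  qed
  have count_t: "(\<lambda>n. real n * p (t * xs n) / b n) \<longlonglongrightarrow> t powr (- \<alpha>)" if t: "t > 0" for t
  proof -
    have "(\<lambda>n. (real n * p (xs n) / b n) * (p (t * xs n) / p (xs n))) \<longlonglongrightarrow> 1 * t powr (- \<alpha>)"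
      by (intro tendsto_mult count_1 filterlim_compose[OF rv.regular[OF t] xs_inf])
    moreover have "eventually (\<lambda>n. (real n * p (xs n) / b n) * (p (t * xs n) / p (xs n))
        = real n * p (t * xs n) / b n) sequentially"
      using xs_pos
    proof eventually_elim
      case (elim n)
      then show ?case using rv.positive[of "xs n"] by simp
    qed
    ultimately show ?thesis using Lim_transform_eventually by fastforce
  qed

  define e where "e = (\<lambda>n x. \<integral>\<omega>. max 0 (exceedances T chi {..<n} x \<omega> - real (b n)) \<partial>M)"
  define s where "s = (\<lambda>n t. indicator {0<..} t * (e n (t * xs n) / b n))"
  define f where "f = (\<lambda>t. indicator {0<..} t * max 0 (t powr (- \<alpha>) - 1))"
  have e_nonneg: "e n x \<ge> 0" for n x by (simp add: e_def)
  have e_meas [measurable]: "e n \<in> borel_measurable borel" for n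
    using expected_excess_measurable by (simp add: e_def)
  have s_meas: "s n \<in> borel_measurable lborel" for n unfolding s_def by measurable
  have e_le_mean: "e n x \<le> real n * p x" for n x
    unfolding e_def p_def exceedances_expectation[symmetric]
    by (intro integral_mono excess_integrable exceedances_integrable) (auto simp: exceedances_bounds)

  obtain K where K: "K \<ge> 0" "\<And>x n. x \<ge> 0 \<Longrightarrow>
    (\<integral>\<omega>. (exceedances T chi {..<n} x \<omega> - real n * p x)\<^sup>2 \<partial>M) \<le> K * (real n * p x)"
    using exceedances_variance[OF D] unfolding p_def by blast
  have pointwise: "(\<lambda>n. s n t) \<longlonglongrightarrow> f t" for t
  proof (cases "t > 0")
    case True
    \<comment> \<open>The variance bound needs nonnegative levels, which \<open>t * xs n\<close> are only eventually.\<close>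
    have "(\<lambda>n. e n (max 0 (t * xs n)) / b n) \<longlonglongrightarrow> max 0 (t powr (- \<alpha>) - 1)"
      unfolding e_def
    proof (rule expected_excess_tendsto[where K = K and x = "\<lambda>n. max 0 (t * xs n)"])
      show "(\<integral>\<omega>. (exceedances T chi {..<n} (max 0 (t * xs n)) \<omega> - real n * tail_prob (max 0 (t * xs n)))\<^sup>2 \<partial>M)
          \<le> K * (real n * tail_prob (max 0 (t * xs n)))" for n
        using K(2)[of "max 0 (t * xs n)" n] by (simp add: p_def)
      have "eventually (\<lambda>n. real n * p (t * xs n) / b n = real n * p (max 0 (t * xs n)) / b n) sequentially"
        using xs_pos by eventually_elim (use True in \<open>simp add: max_def\<close>)
      then have "(\<lambda>n. real n * p (max 0 (t * xs n)) / b n) \<longlonglongrightarrow> t powr (- \<alpha>)"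
        using count_t[OF True] by (rule Lim_transform_eventually[rotated])
      then show "(\<lambda>n. real n * tail_prob (max 0 (t * xs n)) / b n) \<longlonglongrightarrow> t powr (- \<alpha>)"
        by (simp add: p_def)
    qed (rule b_infinity)
    moreover have "eventually (\<lambda>n. e n (max 0 (t * xs n)) / b n = s n t) sequentially"
      using xs_pos by eventually_elim (use True in \<open>simp add: s_def max_def\<close>)
    ultimately have "(\<lambda>n. s n t) \<longlonglongrightarrow> max 0 (t powr (- \<alpha>) - 1)" by (rule Lim_transform_eventually)
    then show ?thesis using True by (simp add: f_def)
  qed (simp add: s_def f_def)

  \<comment> \<open>For \<open>t \<ge> 1\<close> the right Potter bound with exponent \<open>\<alpha> / 2\<close>, raised to the power \<open>k\<close>, decays
    at least like \<open>t powr (- 2)\<close>.\<close>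
  define k where "k = nat \<lceil>4 / \<alpha>\<rceil>"
  have k: "\<alpha> / 2 * k \<ge> 2" "k \<ge> 1"
  proof -
    have k4: "real k \<ge> 4 / \<alpha>" by (simp add: k_def real_nat_ceiling_ge)
    then show "\<alpha> / 2 * k \<ge> 2" using alpha by (simp add: field_simps)
    have "4 / \<alpha> > 0" using alpha by simp
    then show "k \<ge> 1" using k4 by linarith
  qed
  obtain C1 where C1: "C1 > 0" "\<And>n b x. b \<ge> r * k \<Longrightarrow>
    (\<integral>\<omega>. max 0 (exceedances T chi {..<n} x \<omega> - real b) \<partial>M) \<le> C1 * b * (n * p x / b) ^ k"
    by (rule excess_polynomial_bound[OF k(2), unfolded p_eq]) blast
  \<comment> \<open>For \<open>t \<le> 1\<close> the exponent of the left Potter bound has to lie between \<open>\<alpha>\<close> and one, where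
    \<open>t powr (- \<gamma>)\<close> is integrable at zero.\<close>
  define \<gamma> where "\<gamma> = (1 + \<alpha>) / 2"
  have \<gamma>: "\<alpha> < \<gamma>" "0 < \<gamma>" "\<gamma> < 1" using alpha by (auto simp: \<gamma>_def)
  have half: "0 < \<alpha>/2" "\<alpha>/2 < \<alpha>" using alpha by auto
  obtain z1 where z1: "\<And>z t. z \<ge> z1 \<Longrightarrow> t \<ge> 1 \<Longrightarrow> p (t * z) \<le> 2 powr (\<alpha>/2) * t powr (- (\<alpha>/2)) * p z"
    by (rule rv.potter_bound_right[OF half]) blast
  obtain z2 C2 where C2: "C2 > 0"
    and z2: "\<And>z t. z \<ge> z2 \<Longrightarrow> 0 < t \<Longrightarrow> t \<le> 1 \<Longrightarrow> p (t * z) \<le> C2 * t powr (- \<gamma>) * p z"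
    by (rule rv.potter_bound_left[OF \<gamma>(1,2)]) blast
  define C3 where "C3 = C1 * (2 powr (\<alpha>/2) * 2) ^ k"
  define w where "w = (\<lambda>t::real. 2 * C2 * (indicator {0..1} t * t powr (- \<gamma>)) + C3 * (indicator {1..} t * t powr (- 2)))"
  have C3: "C3 \<ge> 0" using C1 by (simp add: C3_def)
  have "integrable lborel (\<lambda>t::real. indicator {0..1} t * t powr (- \<gamma>))"
    using power_integral_unit_interval[of "- \<gamma>"] \<gamma> by (auto simp: has_bochner_integral_iff)
  then have w_int: "integrable lborel w"
    unfolding w_def
    by (intro Bochner_Integration.integrable_add integrable_mult_right power_integrable_at_infinity)
  have "eventually (\<lambda>n. xs n \<ge> max z1 z2 \<and> xs n > 0 \<and> real n * p (xs n) / b n < 2 \<and> b n \<ge> r * k \<and> n \<ge> 1) sequentially"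
    using xs_inf xs_pos order_tendstoD(2)[OF count_1, of 2] b_infinity n_pos
    by (intro eventually_conj) (auto simp: filterlim_at_top simp del: max.bounded_iff)
  then obtain n0 where n0: "\<And>n. n \<ge> n0 \<Longrightarrow> xs n \<ge> max z1 z2 \<and> xs n > 0 \<and> real n * p (xs n) / b n < 2 \<and> b n \<ge> r * k \<and> n \<ge> 1"
    by (auto simp: eventually_sequentially)
  have dominated: "norm (s n t) \<le> w t" if n: "n \<ge> n0" for n t
  proof -
    note N = n0[OF n]
    have bn: "real (b n) > 0" using N b_pos[of n] by simp
    have cnt: "0 \<le> real n * p (xs n) / b n" "real n * p (xs n) / b n \<le> 2"
      using N p_nonneg by auto
    have s0: "s n t \<ge> 0" using e_nonneg by (simp add: s_def)
    have w0: "0 \<le> 2 * C2 * (indicator {0..1} t * t powr (- \<gamma>))" "0 \<le> C3 * (indicator {1..} t * t powr (- 2))"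
      using C2 C3 by auto
    consider "t \<le> 0" | "0 < t" "t \<le> 1" | "t > 1" by linarith
    then have "s n t \<le> w t"
    proof cases
      case 1
      then show ?thesis using w0 by (simp add: s_def w_def)
    next
      case 2
      have "s n t \<le> real n * p (t * xs n) / b n"
        using 2 e_le_mean[of n "t * xs n"] bn by (simp add: s_def divide_right_mono)
      also have "\<dots> \<le> real n * (C2 * t powr (- \<gamma>) * p (xs n)) / b n"
        using z2[of "xs n" t] N 2 by (intro divide_right_mono mult_left_mono) auto
      also have "\<dots> = (C2 * t powr (- \<gamma>)) * (real n * p (xs n) / b n)" by simp
      also have "\<dots> \<le> (C2 * t powr (- \<gamma>)) * 2" using cnt C2 by (intro mult_left_mono) auto
      finally show ?thesis using 2 w0(2) by (simp add: w_def)
    next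
      case 3
      have "s n t \<le> C1 * (real n * p (t * xs n) / b n) ^ k"
        using 3 C1(2)[of "b n" n "t * xs n"] N bn
        by (simp add: s_def e_def divide_le_eq mult_ac)
      also have "\<dots> \<le> C1 * (real n * (2 powr (\<alpha>/2) * t powr (- (\<alpha>/2)) * p (xs n)) / b n) ^ k"
        using z1[of "xs n" t] N 3 p_nonneg C1(1)
        by (intro mult_left_mono power_mono divide_right_mono) auto
      also have "\<dots> = C1 * ((2 powr (\<alpha>/2) * t powr (- (\<alpha>/2))) * (real n * p (xs n) / b n)) ^ k" by (simp add: mult_ac)
      also have "\<dots> \<le> C1 * ((2 powr (\<alpha>/2) * t powr (- (\<alpha>/2))) * 2) ^ k"
        using cnt C1(1) by (intro mult_left_mono power_mono mult_nonneg_nonneg) auto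
      also have "\<dots> = C3 * (t powr (- (\<alpha>/2))) ^ k" by (simp add: C3_def power_mult_distrib)
      also have "(t powr (- (\<alpha>/2))) ^ k = t powr (- (\<alpha>/2 * k))"
        using 3 by (simp add: powr_powr flip: powr_realpow)
      also have "C3 * \<dots> \<le> C3 * t powr (- 2)"
        using k 3 C3 by (intro mult_left_mono powr_mono) auto
      finally show ?thesis using 3 by (simp add: w_def)
    qed
    then show ?thesis using s0 by simp
  qed
  have "(\<lambda>n. \<integral>t. s (n + n0) t \<partial>lborel) \<longlonglongrightarrow> (\<integral>t. f t \<partial>lborel)"
  proof (rule integral_dominated_convergence[OF _ s_meas w_int])
    show "f \<in> borel_measurable lborel" unfolding f_def by measurable
    show "AE t in lborel. (\<lambda>n. s (n + n0) t) \<longlonglongrightarrow> f t"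
      by (intro AE_I2 LIMSEQ_ignore_initial_segment pointwise)
  qed (use dominated in auto)
  then have "(\<lambda>n. \<integral>t. s n t \<partial>lborel) \<longlonglongrightarrow> \<alpha> / (1 - \<alpha>)"
    unfolding f_def limit_excess_integral[OF alpha] by (rule LIMSEQ_offset)
  then have "(\<lambda>n. (\<integral>t. s n t \<partial>lborel) / (\<alpha> / (1 - \<alpha>))) \<longlonglongrightarrow> (\<alpha> / (1 - \<alpha>)) / (\<alpha> / (1 - \<alpha>))"
    by (rule tendsto_divide[OF _ tendsto_const]) (use alpha in simp)
  then have lim: "(\<lambda>n. (\<integral>t. s n t \<partial>lborel) / (\<alpha> / (1 - \<alpha>))) \<longlonglongrightarrow> 1" using alpha by simp
  have "eventually (\<lambda>n. (\<integral>t. s n t \<partial>lborel) / (\<alpha> / (1 - \<alpha>))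
      = (\<integral>x. trimmed_sum T chi n (b n) x \<partial>M) / d n) sequentially"
    using n_pos xs_pos
  proof eventually_elim
    case (elim n)
    have bn: "real (b n) > 0" using b_pos[of n] elim by simp
    have "(\<integral>x. trimmed_sum T chi n (b n) x \<partial>M) = (\<integral>x. indicator {0<..} x * e n x \<partial>lborel)"
      unfolding e_def by (rule expectation_trimmed_sum[OF chi_nonneg])
    also have "\<dots> = \<bar>xs n\<bar> *\<^sub>R (\<integral>t. indicator {0<..} (0 + xs n * t) * e n (0 + xs n * t) \<partial>lborel)"
      by (rule lborel_integral_real_affine) (use elim in simp)
    also have "(\<integral>t. indicator {0<..} (0 + xs n * t) * e n (0 + xs n * t) \<partial>lborel) = (\<integral>t. b n * s n t \<partial>lborel)"
      by (intro Bochner_Integration.integral_cong refl)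
        (use elim bn in \<open>auto simp: s_def indicator_def zero_less_mult_iff mult.commute\<close>)
    finally have lhs: "(\<integral>x. trimmed_sum T chi n (b n) x \<partial>M) = b n * xs n * (\<integral>t. s n t \<partial>lborel)"
      using elim by simp
    have "real n powr (1 / \<alpha>) * real (b n) powr (1 - 1 / \<alpha>) = b n * y n"
      using bn by (simp add: y_def powr_divide powr_diff)
    then have "d n = \<alpha> / (1 - \<alpha>) * (b n * xs n)"
      using d_eq[of n] elim by (simp add: xs_def y_def mult_ac)
    then show ?case unfolding lhs using elim bn by simp
  qed
  with lim show ?thesis by (rule Lim_transform_eventually)
qed

end
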